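(* Let $k\ge 2$, let $D\subset\mathbb{R}^n$ be open, let $T>0$, $\varepsilon_0>0$, and let $F_i:\mathbb{R}\times D\to\mathbb{R}^n$ ($i=1,\ldots,k$) and $R:\mathbb{R}\times D\times[-\varepsilon_0,\varepsilon_0]\to\mathbb{R}^n$ be smooth functions that are $T$-periodic in the variable $t$. Consider the differential equation $$x'=\sum_{i=1}^k\varepsilon^iF_i(t,x)+\varepsilon^{k+1}R(t,x,\varepsilon).$$ Let $\mathbf{g}_1,\ldots,\mathbf{g}_k:D\to\mathbb{R}^n$ be its stroboscopic averaged functions and let $\mathbf{f}_1,\ldots,\mathbf{f}_k:D\to\mathbb{R}^n$ be its Melnikov functions (both defined in the context). Let $\ell\in\{2,\ldots,k\}$. If either $\mathbf{f}_1=\cdots=\mathbf{f}_{\ell-1}=0$ or $\mathbf{g}_1=\cdots=\mathbf{g}_{\ell-1}=0$ (identically on $D$), then $\mathbf{f}_i=T\,\mathbf{g}_i$ for every $i\in\{1,\ldots,\ell\}$.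
   Context: Setting: the differential equation is $x'=\sum_{i=1}^k\varepsilon^iF_i(t,x)+\varepsilon^{k+1}R(t,x,\varepsilon)$, with all data smooth and $T$-periodic in $t$. Partial Bell polynomials: for positive integers $p\ge q$, $$B_{p,q}(x_1,\ldots,x_{p-q+1})=\sum\frac{p!}{b_1!\,b_2!\cdots b_{p-q+1}!}\prod_{j=1}^{p-q+1}\left(\frac{x_j}{j!}\right)^{b_j},$$ where the sum is over all tuples of nonnegative integers $(b_1,\ldots,b_{p-q+1})$ with $b_1+2b_2+\cdots+(p-q+1)b_{p-q+1}=p$ and $b_1+\cdots+b_{p-q+1}=q$. $\partial_x^mF(s,z)$ denotes the $m$-th Fréchet derivative of $F$ in the space variable at $z$, a symmetric $m$-multilinear map. An expression $\partial_x^mF(s,z)\,B_{j,m}(v_1,\ldots,v_{j-m+1})$ with $v_l\in\mathbb{R}^n$ means: each monomial of $B_{j,m}$ is a formal (symmetric) product of $m$ vectors, and the multilinear map is applied to those $m$ vectors, extended linearly. Melnikov functions: define $y_1(t,z)=\int_0^tF_1(s,z)\,ds$ and, for $i\in\{2,\ldots,k\}$, $$y_i(t,z)=\int_0^t\bigg(i!\,F_i(s,z)+\sum_{j=1}^{i-1}\sum_{m=1}^j\frac{i!}{j!}\,\partial_x^mF_{i-j}(s,z)\,B_{j,m}\big(y_1,\ldots,y_{j-m+1}\big)(s,z)\bigg)ds.$$ Then $\mathbf{f}_i(z)=y_i(T,z)/i!$ for $i\in\{1,\ldots,k\}$. (It is a known fact that the solution $x(t,z,\varepsilon)$ with $x(0,z,\varepsilon)=z$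 satisfies $x(t,z,\varepsilon)=z+\sum_{i=1}^k\varepsilon^iy_i(t,z)/i!+\mathcal{O}(\varepsilon^{k+1})$.) Stroboscopic averaged functions: it is a known fact that there exist smooth functions $\mathbf{u}_i:\mathbb{R}\times D\to\mathbb{R}^n$, $T$-periodic in $t$, and smooth functions $\mathbf{g}_i:D\to\mathbb{R}^n$, $i=1,\ldots,k$, such that the near-identity transformation $x=U(t,\xi,\varepsilon)=\xi+\sum_{i=1}^k\varepsilon^i\mathbf{u}_i(t,\xi)$ satisfies the stroboscopic condition $U(0,\xi,\varepsilon)=\xi$ and transforms the differential equation into $$\xi'=\sum_{i=1}^k\varepsilon^i\mathbf{g}_i(\xi)+\varepsilon^{k+1}r_k(t,\xi,\varepsilon)$$ with $r_k$ smooth and $T$-periodic in $t$. "Transforms" means that $$\partial_tU(t,\xi,\varepsilon)+\partial_\xi U(t,\xi,\varepsilon)\Big(\sum_{i=1}^k\varepsilon^i\mathbf{g}_i(\xi)+\varepsilon^{k+1}r_k(t,\xi,\varepsilon)\Big)=\sum_{i=1}^k\varepsilon^iF_i(t,U(t,\xi,\varepsilon))+\varepsilon^{k+1}R(t,U(t,\xi,\varepsilon),\varepsilon),$$ where, as usual, this is required locally: for each open $V$ with compact closure contained in $D$, there is $\varepsilon_V\in(0,\varepsilon_0]$ such that for $\xi\in V$ and $|\varepsilon|\le\varepsilon_V$ one has $U(t,\xi,\varepsilon)\in D$ for all $t$ and $r_k$ is defined and smooth. The functions $\mathbf{g}_1,\ldots,\mathbf{g}_k$ are uniquely determined by these requirements;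 $\mathbf{g}_i$ is called the stroboscopic averaged function of order $i$. *)

theory Defs
  imports "HOL-Analysis.Analysis"
begin

(* Derivatives are taken within S, so that closed parameter ranges such as
   UNIV \<times> D \<times> {-e..e} (D open, e > 0) are covered; on these sets, as on open sets,
   the derivative within S is unique.  In finite dimension, being C^(Suc k) amounts to being
   differentiable with all directional derivatives C^k. *)
primrec Ck_on :: "nat \<Rightarrow> 'a::euclidean_space set \<Rightarrow> ('a \<Rightarrow> 'b::euclidean_space) \<Rightarrow> bool" where
  "Ck_on 0 S f \<longleftrightarrow> continuous_on S f"
| "Ck_on (Suc k) S f \<longleftrightarrow>
     f differentiable_on S \<and> (\<forall>v. Ck_on k S (\<lambda>x. frechet_derivative f (at x within S) v))"

definition smooth_on :: "'a::euclidean_space set \<Rightarrow> ('a \<Rightarrow> 'b::euclidean_space) \<Rightarrow> bool" where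
  "smooth_on S f \<longleftrightarrow> (\<forall>k. Ck_on k S f)"

(* frechet_nth f [v1, ..., vm] z is the m-th Frechet derivative of f at z, as an m-linear map,
   applied to (v1, ..., vm): the derivative at z, in direction v1, of the map sending x to the
   (m-1)-st derivative at x applied to (v2, ..., vm). *)
primrec frechet_nth ::
  "('a::euclidean_space \<Rightarrow> 'b::euclidean_space) \<Rightarrow> 'a list \<Rightarrow> 'a \<Rightarrow> 'b" where
  "frechet_nth f [] z = f z"
| "frechet_nth f (v # vs) z = frechet_derivative (\<lambda>x. frechet_nth f vs x) (at z) v"

(* A tuple (b_1, ..., b_(p-q+1)) is a function vanishing outside {1..p-q+1}. *)
definition bell_tuples :: "nat \<Rightarrow> nat \<Rightarrow> (nat \<Rightarrow> nat) set" where
  "bell_tuples p q =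
     {b. (\<forall>j. j \<notin> {1..p - q + 1} \<longrightarrow> b j = 0) \<and>
         (\<Sum>j=1..p - q + 1. j * b j) = p \<and> (\<Sum>j=1..p - q + 1. b j) = q}"

lemma finite_bell_tuples: "finite (bell_tuples p q)"
proof (rule finite_subset)
  let ?A = "{1..p - q + 1}"
  show "bell_tuples p q \<subseteq> {b. \<forall>j. (j \<in> ?A \<longrightarrow> b j \<in> {..q}) \<and> (j \<notin> ?A \<longrightarrow> b j = 0)}"
  proof
    fix b assume b: "b \<in> bell_tuples p q"
    then have "b j \<le> q" if "j \<in> ?A" for j
      using member_le_sum[of j ?A b] that unfolding bell_tuples_def by simp
    with b show "b \<in> {b. \<forall>j. (j \<in> ?A \<longrightarrow> b j \<in> {..q}) \<and> (j \<notin> ?A \<longrightarrow> b j = 0)}"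
      unfolding bell_tuples_def by simp
  qed
  show "finite {b. \<forall>j. (j \<in> ?A \<longrightarrow> b j \<in> {..q}) \<and> (j \<notin> ?A \<longrightarrow> b j = (0::nat))}"
    by (rule finite_set_of_finite_funs) auto
qed

(* L applied to the partial Bell polynomial B_{p,q}(v 1, ..., v (p-q+1)), where L is a symmetric
   q-linear map taking the list of its arguments: the monomial with exponents b stands for the
   list containing v j exactly b j times, j = 1, ..., p-q+1. *)
definition bell_apply ::
  "nat \<Rightarrow> nat \<Rightarrow> ('a list \<Rightarrow> 'b::real_vector) \<Rightarrow> (nat \<Rightarrow> 'a) \<Rightarrow> 'b" where
  "bell_apply p q L v =
     (\<Sum>b\<in>bell_tuples p q.
        (fact p / (\<Prod>j=1..p - q + 1. fact (b j)) * (\<Prod>j=1..p - q + 1. (1 / fact j) ^ b j)) *\<^sub>R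
          L (concat (map (\<lambda>j. replicate (b j) (v j)) [1..<p - q + 2])))"

lemma bell_apply_cong [fundef_cong]:
  assumes "p = p'" "q = q'" "L = L'" "\<And>j. 1 \<le> j \<Longrightarrow> j \<le> p' - q' + 1 \<Longrightarrow> v j = v' j"
  shows "bell_apply p q L v = bell_apply p' q' L' v'"
proof -
  have "map (\<lambda>j. replicate (b j) (v j)) [1..<p' - q' + 2] =
        map (\<lambda>j. replicate (b j) (v' j)) [1..<p' - q' + 2]" for b :: "nat \<Rightarrow> nat"
    using assms(4) by (intro map_cong) auto
  then show ?thesis
    unfolding bell_apply_def assms(1-3) by (simp only:)
qed

(* For i = 1 the double sum is empty, so melnikov_y F 1 t z is the integral of F 1 s z over s
   from 0 to t.  Only indices i \<ge> 1 are meaningful. *)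
function melnikov_y ::
  "(nat \<Rightarrow> real \<Rightarrow> 'a \<Rightarrow> 'a) \<Rightarrow> nat \<Rightarrow> real \<Rightarrow> 'a \<Rightarrow> 'a::euclidean_space" where
  "melnikov_y F i t z =
     (LBINT s=0..t. fact i *\<^sub>R F i s z +
        (\<Sum>j\<in>{1..<i}. \<Sum>m\<in>{1..j}. (fact i / fact j) *\<^sub>R
           bell_apply j m (\<lambda>vs. frechet_nth (F (i - j) s) vs z) (\<lambda>l. melnikov_y F l s z)))"
  by auto
termination
  by (relation "Wellfounded.measure (\<lambda>(F, i, t, z). i)") auto

declare melnikov_y.simps [simp del]

definition melnikov ::
  "(nat \<Rightarrow> real \<Rightarrow> 'a \<Rightarrow> 'a) \<Rightarrow> real \<Rightarrow> nat \<Rightarrow> 'a \<Rightarrow> 'a::euclidean_space" where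
  "melnikov F T i z = melnikov_y F i T z /\<^sub>R fact i"

definition near_identity ::
  "nat \<Rightarrow> (nat \<Rightarrow> real \<Rightarrow> 'a \<Rightarrow> 'a) \<Rightarrow> real \<Rightarrow> 'a \<Rightarrow> real \<Rightarrow> 'a::euclidean_space" where
  "near_identity k u t \<xi> \<epsilon> = \<xi> + (\<Sum>i=1..k. \<epsilon> ^ i *\<^sub>R u i t \<xi>)"

(* g 1, ..., g k (on D) are the stroboscopic averaged functions of
   x' = (\<Sum>i=1..k. \<epsilon>^i F i t x) + \<epsilon>^(k+1) R t x \<epsilon>.
   They are uniquely determined, hence a predicate on g.  The function r plays the role of r_k;
   its values matter only on the sets UNIV \<times> V \<times> {-\<epsilon>\<^sub>V..\<epsilon>\<^sub>V}. *)
definition stroboscopic_averaged ::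
  "'a::euclidean_space set \<Rightarrow> real \<Rightarrow> real \<Rightarrow> nat \<Rightarrow> (nat \<Rightarrow> real \<Rightarrow> 'a \<Rightarrow> 'a) \<Rightarrow>
     (real \<Rightarrow> 'a \<Rightarrow> real \<Rightarrow> 'a) \<Rightarrow> (nat \<Rightarrow> 'a \<Rightarrow> 'a) \<Rightarrow> bool" where
  "stroboscopic_averaged D T \<epsilon>\<^sub>0 k F R g \<longleftrightarrow>
     (\<forall>i\<in>{1..k}. smooth_on D (g i)) \<and>
     (\<exists>u r.
        (\<forall>i\<in>{1..k}. smooth_on (UNIV \<times> D) (\<lambda>(t, \<xi>). u i t \<xi>) \<and>
                     (\<forall>t. \<forall>\<xi>\<in>D. u i (t + T) \<xi> = u i t \<xi>)) \<and>
        (\<forall>\<xi>\<in>D. \<forall>\<epsilon>\<in>{-\<epsilon>\<^sub>0..\<epsilon>\<^sub>0}. near_identity k u 0 \<xi> \<epsilon> = \<xi>) \<and>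
        (\<forall>V. open V \<and> compact (closure V) \<and> closure V \<subseteq> D \<longrightarrow>
           (\<exists>\<epsilon>\<^sub>V\<in>{0<..\<epsilon>\<^sub>0}.
              smooth_on (UNIV \<times> V \<times> {-\<epsilon>\<^sub>V..\<epsilon>\<^sub>V}) (\<lambda>(t, \<xi>, \<epsilon>). r t \<xi> \<epsilon>) \<and>
              (\<forall>t. \<forall>\<xi>\<in>V. \<forall>\<epsilon>\<in>{-\<epsilon>\<^sub>V..\<epsilon>\<^sub>V}.
                 r (t + T) \<xi> \<epsilon> = r t \<xi> \<epsilon> \<and>
                 near_identity k u t \<xi> \<epsilon> \<in> D \<and>
                 vector_derivative (\<lambda>s. near_identity k u s \<xi> \<epsilon>) (at t) +
                 frechet_derivative (\<lambda>x. near_identity k u t x \<epsilon>) (at \<xi>)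
                   ((\<Sum>i=1..k. \<epsilon> ^ i *\<^sub>R g i \<xi>) + \<epsilon> ^ (k + 1) *\<^sub>R r t \<xi> \<epsilon>) =
                 (\<Sum>i=1..k. \<epsilon> ^ i *\<^sub>R F i t (near_identity k u t \<xi> \<epsilon>)) +
                 \<epsilon> ^ (k + 1) *\<^sub>R R t (near_identity k u t \<xi> \<epsilon>) \<epsilon>))))"

end

theory Submission
  imports Defs
begin

text \<open>
  The proof compares the coefficients of the powers of $\varepsilon$ in the equation which states that
  $U(t, \xi, \varepsilon) = \xi + \sum_i \varepsilon^i \mathbf{u}_i(t, \xi)$ transforms one differential
  equation into the other. Fix a point $z$ and suppose that $\mathbf{g}_j(z) = 0$ for all $j < i$. Then
  the averaged vector field at $z$ is $\varepsilon^i \mathbf{g}_i(z) + O(\varepsilon^{i+1})$, and as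
  $\partial_\xi U = \mathrm{id} + O(\varepsilon)$, the coefficient of $\varepsilon^i$ on the left is
  $\partial_t \mathbf{u}_i(t, z) + \mathbf{g}_i(z)$. On the right it is the coefficient of
  $\varepsilon^i$ in $\sum_j \varepsilon^j F_j(t, U(t, z, \varepsilon))$ (lemma \<open>coefficient_identity\<close>).

  The Melnikov recursion integrates these same coefficients, with $y_l / l!$ in place of
  $\mathbf{u}_l$ (lemma \<open>faa_di_bruno_expands\<close> gives the coefficients in terms of Bell polynomials).
  Induction on $i$ therefore yields
  $y_i(t, z) = i!\,(\mathbf{u}_i(t, z) + t\,\mathbf{g}_i(z))$, and at $t = T$ the periodic function
  $\mathbf{u}_i$, which vanishes at $t = 0$, drops out: $\mathbf{f}_i(z) = T\,\mathbf{g}_i(z)$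
  (lemma \<open>melnikov_eq_averaged\<close>). If the $\mathbf{g}_j$ vanish for $j < \ell$, this is the claim. If the
  $\mathbf{f}_j$ vanish for $j < \ell$, it shows successively that
  $\mathbf{g}_1, \ldots, \mathbf{g}_{\ell-1}$ vanish, and the first case applies.

  The formula of Faa di Bruno is obtained from Taylor expansions with remainder in one direction after
  the other, in the order in which the multilinear maps list their arguments.
\<close>

section \<open>Orders of vanishing and asymptotic expansions in the parameter\<close>

text \<open>
  This is $\varphi(\varepsilon) = O(|\varepsilon|^p)$ as $\varepsilon \to 0$. The value at $\varepsilon = 0$
  is ignored, as in limits at $0$.
\<close>

definition vanishes_to_order :: "nat \<Rightarrow> (real \<Rightarrow> 'b::real_normed_vector) \<Rightarrow> bool" where
  "vanishes_to_order p \<phi> \<longleftrightarrow> (\<exists>C. \<forall>\<^sub>F \<epsilon> in at 0. norm (\<phi> \<epsilon>) \<le> C * \<bar>\<epsilon>\<bar> ^ p)"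

lemma vanishes_to_order_cong:
  assumes "vanishes_to_order p \<phi>" "\<forall>\<^sub>F \<epsilon> in at 0. \<phi> \<epsilon> = \<psi> \<epsilon>"
  shows "vanishes_to_order p \<psi>"
proof -
  obtain C where "\<forall>\<^sub>F \<epsilon> in at 0. norm (\<phi> \<epsilon>) \<le> C * \<bar>\<epsilon>\<bar> ^ p"
    using assms(1) unfolding vanishes_to_order_def by blast
  then have "\<forall>\<^sub>F \<epsilon> in at 0. norm (\<psi> \<epsilon>) \<le> C * \<bar>\<epsilon>\<bar> ^ p"
    using assms(2) by eventually_elim simp
  then show ?thesis unfolding vanishes_to_order_def by blast
qed

lemma vanishes_to_order_0 [simp]: "vanishes_to_order p (\<lambda>_. 0)"
  unfolding vanishes_to_order_def by (intro exI[of _ 0]) simp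

lemma vanishes_to_order_add:
  assumes "vanishes_to_order p \<phi>" "vanishes_to_order p \<psi>"
  shows "vanishes_to_order p (\<lambda>\<epsilon>. \<phi> \<epsilon> + \<psi> \<epsilon>)"
proof -
  obtain C C' where "\<forall>\<^sub>F \<epsilon> in at 0. norm (\<phi> \<epsilon>) \<le> C * \<bar>\<epsilon>\<bar> ^ p"
    "\<forall>\<^sub>F \<epsilon> in at 0. norm (\<psi> \<epsilon>) \<le> C' * \<bar>\<epsilon>\<bar> ^ p"
    using assms unfolding vanishes_to_order_def by blast
  then have "\<forall>\<^sub>F \<epsilon> in at 0. norm (\<phi> \<epsilon> + \<psi> \<epsilon>) \<le> (C + C') * \<bar>\<epsilon>\<bar> ^ p"
    by eventually_elim (simp add: distrib_right norm_triangle_le)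
  then show ?thesis unfolding vanishes_to_order_def by blast
qed

lemma vanishes_to_order_sum:
  assumes "\<And>i. i \<in> I \<Longrightarrow> vanishes_to_order p (\<phi> i)"
  shows "vanishes_to_order p (\<lambda>\<epsilon>. \<Sum>i\<in>I. \<phi> i \<epsilon>)"
  using assms by (induction I rule: infinite_finite_induct) (auto intro: vanishes_to_order_add)

lemma vanishes_to_order_bounded_linear:
  assumes "bounded_linear A" "vanishes_to_order p \<phi>"
  shows "vanishes_to_order p (\<lambda>\<epsilon>. A (\<phi> \<epsilon>))"
proof -
  obtain K where K: "K > 0" "\<And>x. norm (A x) \<le> norm x * K"
    using bounded_linear.pos_bounded[OF assms(1)] by blast
  obtain C where "\<forall>\<^sub>F \<epsilon> in at 0. norm (\<phi> \<epsilon>) \<le> C * \<bar>\<epsilon>\<bar> ^ p"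
    using assms(2) unfolding vanishes_to_order_def by blast
  then have "\<forall>\<^sub>F \<epsilon> in at 0. norm (A (\<phi> \<epsilon>)) \<le> (K * C) * \<bar>\<epsilon>\<bar> ^ p"
  proof eventually_elim
    case (elim \<epsilon>)
    have "norm (\<phi> \<epsilon>) * K \<le> (C * \<bar>\<epsilon>\<bar> ^ p) * K"
      using elim K(1) by (intro mult_right_mono) auto
    then show ?case using K(2)[of "\<phi> \<epsilon>"] by (simp add: mult_ac)
  qed
  then show ?thesis unfolding vanishes_to_order_def by blast
qed

lemma vanishes_to_order_diff:
  assumes "vanishes_to_order p \<phi>" "vanishes_to_order p \<psi>"
  shows "vanishes_to_order p (\<lambda>\<epsilon>. \<phi> \<epsilon> - \<psi> \<epsilon>)"
  using vanishes_to_order_add[OF assms(1)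
      vanishes_to_order_bounded_linear[OF bounded_linear_minus[OF bounded_linear_ident] assms(2)]]
  by simp

lemma vanishes_to_order_scaleR:
  assumes "vanishes_to_order p c" "vanishes_to_order q \<phi>"
  shows "vanishes_to_order (p + q) (\<lambda>\<epsilon>. c \<epsilon> *\<^sub>R \<phi> \<epsilon>)"
proof -
  obtain C C' where "\<forall>\<^sub>F \<epsilon> in at 0. norm (c \<epsilon>) \<le> C * \<bar>\<epsilon>\<bar> ^ p"
    "\<forall>\<^sub>F \<epsilon> in at 0. norm (\<phi> \<epsilon>) \<le> C' * \<bar>\<epsilon>\<bar> ^ q"
    using assms unfolding vanishes_to_order_def by blast
  then have "\<forall>\<^sub>F \<epsilon> in at 0. norm (c \<epsilon> *\<^sub>R \<phi> \<epsilon>) \<le> (C * C') * \<bar>\<epsilon>\<bar> ^ (p + q)"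
  proof eventually_elim
    case (elim \<epsilon>)
    have "norm (c \<epsilon>) * norm (\<phi> \<epsilon>) \<le> (C * \<bar>\<epsilon>\<bar> ^ p) * (C' * \<bar>\<epsilon>\<bar> ^ q)"
      using elim by (intro mult_mono) (auto intro: order_trans[OF norm_ge_zero])
    then show ?case by (simp add: power_add mult_ac)
  qed
  then show ?thesis unfolding vanishes_to_order_def by blast
qed

lemma vanishes_to_order_mono:
  assumes "vanishes_to_order q \<phi>" "p \<le> q"
  shows "vanishes_to_order p \<phi>"
proof -
  obtain C where C: "\<forall>\<^sub>F \<epsilon> in at 0. norm (\<phi> \<epsilon>) \<le> C * \<bar>\<epsilon>\<bar> ^ q"
    using assms(1) unfolding vanishes_to_order_def by blast
  have "\<forall>\<^sub>F \<epsilon> in at (0::real). \<bar>\<epsilon>\<bar> \<le> 1"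
    unfolding eventually_at by (rule exI[of _ 1]) (auto simp: dist_real_def)
  with C have "\<forall>\<^sub>F \<epsilon> in at 0. norm (\<phi> \<epsilon>) \<le> \<bar>C\<bar> * \<bar>\<epsilon>\<bar> ^ p"
  proof eventually_elim
    case (elim \<epsilon>)
    have "C * \<bar>\<epsilon>\<bar> ^ q \<le> \<bar>C\<bar> * \<bar>\<epsilon>\<bar> ^ p"
      using elim assms(2) by (intro mult_mono power_decreasing) auto
    with elim show ?case by linarith
  qed
  then show ?thesis unfolding vanishes_to_order_def by blast
qed

text \<open>
  Order $0$ only asks for boundedness near $0$; this is how the remainders of the differential
  equations, multiplied by $\varepsilon^{k+1}$, enter.
\<close>

lemma vanishes_to_order_tendsto:
  assumes "(\<phi> \<longlongrightarrow> L) (at 0)"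
  shows "vanishes_to_order 0 \<phi>"
proof -
  have "\<forall>\<^sub>F \<epsilon> in at 0. norm (\<phi> \<epsilon>) < norm L + 1"
    using order_tendstoD(2)[OF tendsto_norm[OF assms], of "norm L + 1"] by simp
  then have "\<forall>\<^sub>F \<epsilon> in at 0. norm (\<phi> \<epsilon>) \<le> (norm L + 1) * \<bar>\<epsilon>\<bar> ^ 0"
    by eventually_elim simp
  then show ?thesis unfolding vanishes_to_order_def by blast
qed

lemma vanishes_to_order_power: "vanishes_to_order p (\<lambda>\<epsilon>. \<epsilon> ^ p)"
  unfolding vanishes_to_order_def by (rule exI[of _ 1]) (simp add: power_abs)

lemma vanishes_to_order_power_scaleR:
  assumes "vanishes_to_order q \<phi>" "p \<le> j + q"
  shows "vanishes_to_order p (\<lambda>\<epsilon>. \<epsilon> ^ j *\<^sub>R \<phi> \<epsilon>)"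
  using vanishes_to_order_mono[OF vanishes_to_order_scaleR[OF vanishes_to_order_power assms(1)] assms(2)] .

lemma vanishes_to_order_monomial:
  "p \<le> j \<Longrightarrow> vanishes_to_order p (\<lambda>\<epsilon>. \<epsilon> ^ j *\<^sub>R v)"
  by (rule vanishes_to_order_power_scaleR[OF vanishes_to_order_tendsto[OF tendsto_const]]) simp

text \<open>
  Dividing by $|\varepsilon|^p$ leaves a constant bounded by a multiple of $|\varepsilon|$.
\<close>

lemma monomial_coefficient_eq_0:
  assumes "vanishes_to_order (Suc p) (\<lambda>\<epsilon>. \<epsilon> ^ p *\<^sub>R v)"
  shows "v = 0"
proof -
  obtain C where "\<forall>\<^sub>F \<epsilon> in at 0. norm (\<epsilon> ^ p *\<^sub>R v) \<le> C * \<bar>\<epsilon>\<bar> ^ Suc p"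
    using assms unfolding vanishes_to_order_def by blast
  moreover have "\<forall>\<^sub>F \<epsilon> in at (0::real). \<epsilon> \<noteq> 0"
    by (simp add: eventually_at_filter)
  ultimately have "\<forall>\<^sub>F \<epsilon> in at 0. norm v \<le> C * \<bar>\<epsilon>\<bar>"
  proof eventually_elim
    case (elim \<epsilon>)
    have "\<bar>\<epsilon>\<bar> ^ p * norm v \<le> \<bar>\<epsilon>\<bar> ^ p * (C * \<bar>\<epsilon>\<bar>)"
      using elim(1) by (simp add: power_abs mult_ac)
    then show ?case using elim(2) by (simp add: mult_le_cancel_left_pos)
  qed
  moreover have "((\<lambda>\<epsilon>. C * \<bar>\<epsilon>\<bar>) \<longlongrightarrow> C * \<bar>0\<bar>) (at 0)"
    by (intro tendsto_intros)
  ultimately have "norm v \<le> C * \<bar>0\<bar>"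
    by (intro tendsto_le[OF _ _ tendsto_const]) auto
  then show ?thesis by simp
qed

text \<open>
  An expansion with error of order \<open>p\<close>. Its coefficients are given by a function on all of \<open>nat\<close>, so
  that the rules for sums, for products with powers of $\varepsilon$ and for monomials hold without case
  distinctions on \<open>p\<close>.
\<close>

definition expands :: "nat \<Rightarrow> (real \<Rightarrow> 'b::real_normed_vector) \<Rightarrow> (nat \<Rightarrow> 'b) \<Rightarrow> bool" where
  "expands p \<phi> c \<longleftrightarrow> vanishes_to_order p (\<lambda>\<epsilon>. \<phi> \<epsilon> - (\<Sum>q<p. \<epsilon> ^ q *\<^sub>R c q))"

text \<open>
  Uniqueness of expansions rests on this: a polynomial of degree below \<open>p\<close> that vanishes to order \<open>p\<close>
  also does so to order \<open>p - 1\<close>, and so does its top monomial, so induction kills the lower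
  coefficients first and then the top one.
\<close>

lemma polynomial_coefficients_eq_0:
  assumes "vanishes_to_order p (\<lambda>\<epsilon>. \<Sum>q<p. \<epsilon> ^ q *\<^sub>R c q)" "q < p"
  shows "c q = 0"
  using assms
proof (induction p arbitrary: q)
  case (Suc p)
  have "vanishes_to_order p (\<lambda>\<epsilon>. (\<Sum>q<Suc p. \<epsilon> ^ q *\<^sub>R c q) - \<epsilon> ^ p *\<^sub>R c p)"
    by (intro vanishes_to_order_diff vanishes_to_order_monomial
        vanishes_to_order_mono[OF Suc.prems(1)]) auto
  then have low: "c q = 0" if "q < p" for q
    using Suc.IH that by simp
  then have "vanishes_to_order (Suc p) (\<lambda>\<epsilon>. \<epsilon> ^ p *\<^sub>R c p)"
    using Suc.prems(1) by simp
  then have "c p = 0" by (rule monomial_coefficient_eq_0)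
  with low Suc.prems(2) show ?case by (cases "q = p") auto
qed simp

lemma expands_unique:
  assumes "expands p \<phi> c" "expands p \<phi> d" "q < p"
  shows "c q = d q"
proof -
  have "vanishes_to_order p (\<lambda>\<epsilon>. \<Sum>q<p. \<epsilon> ^ q *\<^sub>R (d q - c q))"
    using vanishes_to_order_diff[OF assms(1,2)[unfolded expands_def]]
    by (simp add: scaleR_diff_right sum_subtractf)
  from polynomial_coefficients_eq_0[OF this assms(3)] show ?thesis by simp
qed

lemma expands_cong:
  assumes "expands p \<phi> c" "\<forall>\<^sub>F \<epsilon> in at 0. \<phi> \<epsilon> = \<psi> \<epsilon>"
  shows "expands p \<psi> c"
  unfolding expands_def
  by (rule vanishes_to_order_cong[OF assms(1)[unfolded expands_def] eventually_mono[OF assms(2)]]) simp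

lemma expands_coeff_cong:
  assumes "expands p \<phi> c" "\<And>q. q < p \<Longrightarrow> c q = d q"
  shows "expands p \<phi> d"
proof -
  have "(\<Sum>q<p. \<epsilon> ^ q *\<^sub>R c q) = (\<Sum>q<p. \<epsilon> ^ q *\<^sub>R d q)" for \<epsilon> :: real
    using assms(2) by simp
  with assms(1) show ?thesis unfolding expands_def by simp
qed

lemma expands_vanishing: "vanishes_to_order p \<phi> \<Longrightarrow> expands p \<phi> (\<lambda>_. 0)"
  unfolding expands_def by simp

lemma expands_add:
  assumes "expands p \<phi> c" "expands p \<psi> d"
  shows "expands p (\<lambda>\<epsilon>. \<phi> \<epsilon> + \<psi> \<epsilon>) (\<lambda>q. c q + d q)"
  using vanishes_to_order_add[OF assms[unfolded expands_def]]
  unfolding expands_def by (simp add: scaleR_add_right sum.distrib add_diff_add)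

lemma expands_sum:
  assumes "\<And>i. i \<in> I \<Longrightarrow> expands p (\<phi> i) (c i)"
  shows "expands p (\<lambda>\<epsilon>. \<Sum>i\<in>I. \<phi> i \<epsilon>) (\<lambda>q. \<Sum>i\<in>I. c i q)"
  using assms
proof (induction I rule: infinite_finite_induct)
  case (insert i I)
  then have "expands p (\<lambda>\<epsilon>. \<phi> i \<epsilon> + (\<Sum>i\<in>I. \<phi> i \<epsilon>)) (\<lambda>q. c i q + (\<Sum>i\<in>I. c i q))"
    by (intro expands_add) auto
  with insert.hyps show ?case by simp
qed (simp_all add: expands_vanishing)

lemma expands_shift:
  assumes "expands p \<phi> c"
  shows "expands p (\<lambda>\<epsilon>. \<epsilon> ^ j *\<^sub>R \<phi> \<epsilon>) (\<lambda>q. if q < j then 0 else c (q - j))"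
proof -
  let ?\<psi> = "\<lambda>\<epsilon>. \<epsilon> ^ j *\<^sub>R (\<phi> \<epsilon> - (\<Sum>q<p. \<epsilon> ^ q *\<^sub>R c q))"
  \<comment> \<open>Multiplication by $\varepsilon^j$ makes the terms with index in \<open>?I\<close> vanish to order \<open>p\<close>.\<close>
  let ?I = "{q. q < p \<and> p \<le> j + q}"
  have "vanishes_to_order p (\<lambda>\<epsilon>. ?\<psi> \<epsilon> + (\<Sum>q\<in>?I. \<epsilon> ^ (j + q) *\<^sub>R c q))"
    using assms unfolding expands_def
    by (intro vanishes_to_order_add vanishes_to_order_sum vanishes_to_order_monomial
        vanishes_to_order_power_scaleR) auto
  moreover have "?\<psi> \<epsilon> + (\<Sum>q\<in>?I. \<epsilon> ^ (j + q) *\<^sub>R c q)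
      = \<epsilon> ^ j *\<^sub>R \<phi> \<epsilon> - (\<Sum>q<p. \<epsilon> ^ q *\<^sub>R (if q < j then 0 else c (q - j)))" for \<epsilon>
  proof -
    have "(\<Sum>q<p. \<epsilon> ^ (j + q) *\<^sub>R c q)
        = (\<Sum>q\<in>?I. \<epsilon> ^ (j + q) *\<^sub>R c q) + (\<Sum>q\<in>{q. j + q < p}. \<epsilon> ^ (j + q) *\<^sub>R c q)"
      by (subst sum.union_disjoint[symmetric])
         (auto intro!: sum.cong finite_subset[of "{q. j + q < p}" "{..<p}"])
    moreover have "(\<Sum>q\<in>{q. j + q < p}. \<epsilon> ^ (j + q) *\<^sub>R c q)
        = (\<Sum>q\<in>{q. q < p \<and> j \<le> q}. \<epsilon> ^ q *\<^sub>R c (q - j))"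
      by (rule sum.reindex_bij_witness[of _ "\<lambda>q. q - j" "\<lambda>q. j + q"]) auto
    moreover have "\<dots> = (\<Sum>q<p. \<epsilon> ^ q *\<^sub>R (if q < j then 0 else c (q - j)))"
      by (rule sum.mono_neutral_cong_left) auto
    ultimately show ?thesis
      by (simp add: scaleR_diff_right scaleR_sum_right power_add)
  qed
  ultimately show ?thesis unfolding expands_def by simp
qed

lemma expands_const: "expands p (\<lambda>_. v) (\<lambda>q. if q = 0 then v else 0)"
proof (cases p)
  case 0
  then show ?thesis
    unfolding expands_def by (simp add: vanishes_to_order_tendsto[OF tendsto_const])
next
  case (Suc n)
  have "(\<Sum>q<p. \<epsilon> ^ q *\<^sub>R (if q = 0 then v else 0)) = v" for \<epsilon> :: real
    using Suc by (simp add: if_distrib[of "scaleR _"] cong: if_cong)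
  then show ?thesis unfolding expands_def by simp
qed

lemma expands_monomial: "expands p (\<lambda>\<epsilon>. \<epsilon> ^ j *\<^sub>R v) (\<lambda>q. if q = j then v else 0)"
proof -
  have "(\<lambda>q. if q = j then v else 0) = (\<lambda>q. if q < j then 0 else if q - j = 0 then v else 0)"
    by auto
  then show ?thesis using expands_shift[OF expands_const, of p j v] by metis
qed

lemma expands_polynomial:
  assumes "finite I"
  shows "expands p (\<lambda>\<epsilon>. \<Sum>j\<in>I. \<epsilon> ^ j *\<^sub>R c j) (\<lambda>q. if q \<in> I then c q else 0)"
proof -
  have "(\<lambda>q. \<Sum>j\<in>I. if q = j then c j else 0) = (\<lambda>q. if q \<in> I then c q else 0)"
    using assms by simp
  with expands_sum[of I p "\<lambda>j \<epsilon>. \<epsilon> ^ j *\<^sub>R c j", OF expands_monomial] show ?thesis by simp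
qed

section \<open>Iterated directional derivatives of smooth maps\<close>

lemma frechet_derivative_within_cong:
  assumes "x \<in> S" "\<And>y. y \<in> S \<Longrightarrow> f y = g y"
  shows "frechet_derivative f (at x within S) = frechet_derivative g (at x within S)"
proof -
  have "(f has_derivative f') (at x within S) \<longleftrightarrow> (g has_derivative f') (at x within S)" for f'
    using assms by (metis has_derivative_transform)
  then show ?thesis unfolding frechet_derivative_def by simp
qed

lemma Ck_on_cong:
  assumes "Ck_on k S f" "\<And>x. x \<in> S \<Longrightarrow> f x = g x"
  shows "Ck_on k S g"
  using assms
proof (induction k arbitrary: f g)
  case 0
  then show ?case using continuous_on_cong[of S S f g] by simp
next
  case (Suc k)
  have "g differentiable_on S"
    unfolding differentiable_on_def
  proof
    fix x assume x: "x \<in> S"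
    then have "f differentiable at x within S"
      using Suc.prems(1) by (simp add: differentiable_on_def)
    then show "g differentiable at x within S"
      unfolding differentiable_def using x Suc.prems(2) by (metis has_derivative_transform)
  qed
  moreover have "Ck_on k S (\<lambda>x. frechet_derivative g (at x within S) v)" for v
  proof (rule Suc.IH)
    show "Ck_on k S (\<lambda>x. frechet_derivative f (at x within S) v)"
      using Suc.prems(1) by simp
    show "frechet_derivative f (at x within S) v = frechet_derivative g (at x within S) v"
      if "x \<in> S" for x
      using frechet_derivative_within_cong[OF that Suc.prems(2)] by simp
  qed
  ultimately show ?case by simp
qed

text \<open>
  On an open set the derivatives within the set are the full derivatives; this links \<open>smooth_on\<close>
  with \<open>frechet_nth\<close>, which uses full derivatives.
\<close>

lemma Ck_on_Suc_open:
  assumes "open S"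
  shows "Ck_on (Suc k) S f \<longleftrightarrow>
    (\<forall>x\<in>S. f differentiable at x) \<and> (\<forall>v. Ck_on k S (\<lambda>x. frechet_derivative f (at x) v))"
proof -
  have "Ck_on k S (\<lambda>x. frechet_derivative f (at x within S) v)
      \<longleftrightarrow> Ck_on k S (\<lambda>x. frechet_derivative f (at x) v)" for v
    using Ck_on_cong[where S = S and k = k] at_within_open[OF _ assms]
    by (metis (mono_tags, lifting))
  then show ?thesis
    using at_within_open[OF _ assms] by (simp add: differentiable_on_def)
qed

lemma smooth_on_Ck_on: "smooth_on S f \<Longrightarrow> Ck_on k S f"
  by (simp add: smooth_on_def)

lemma smooth_on_continuous_on: "smooth_on S f \<Longrightarrow> continuous_on S f"
  using smooth_on_Ck_on[of S f 0] by simp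

lemma smooth_on_differentiable:
  assumes "smooth_on S f" "open S" "x \<in> S"
  shows "f differentiable at x"
  using smooth_on_Ck_on[OF assms(1), of 1] assms(3)
  by (simp add: Ck_on_Suc_open[OF assms(2)] del: Ck_on.simps)

lemma smooth_on_frechet_derivative:
  assumes "smooth_on S f" "open S"
  shows "smooth_on S (\<lambda>x. frechet_derivative f (at x) v)"
  unfolding smooth_on_def
proof
  fix k
  show "Ck_on k S (\<lambda>x. frechet_derivative f (at x) v)"
    using smooth_on_Ck_on[OF assms(1), of "Suc k"]
    by (simp add: Ck_on_Suc_open[OF assms(2)] del: Ck_on.simps)
qed

lemma smooth_on_frechet_nth:
  assumes "smooth_on S f" "open S"
  shows "smooth_on S (frechet_nth f vs)"
proof (induction vs)
  case Nil
  have "frechet_nth f [] = f" by (intro ext) simp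
  with assms(1) show ?case by simp
next
  case (Cons v vs)
  have "frechet_nth f (v # vs) = (\<lambda>z. frechet_derivative (frechet_nth f vs) (at z) v)"
    by (intro ext) simp
  with smooth_on_frechet_derivative[OF Cons assms(2)] show ?case by simp
qed

lemma frechet_nth_append: "frechet_nth f (vs @ ws) = frechet_nth (frechet_nth f ws) vs"
proof (induction vs)
  case Nil
  show ?case by (intro ext) simp
next
  case (Cons v vs)
  then show ?case by (intro ext) simp
qed

text \<open>
  Smoothness is assumed jointly in time and space, whereas the Melnikov integrands differentiate in
  space alone. Freezing the time turns space derivatives into derivatives in the directions $(0, v)$.
\<close>

lemma has_derivative_slice:
  assumes "f differentiable at (t, x)"
  shows "((\<lambda>x. f (t, x)) has_derivative (\<lambda>v. frechet_derivative f (at (t, x)) (0, v))) (at x)"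
proof -
  have "(f has_derivative frechet_derivative f (at (t, x))) (at (t, x))"
    using assms by (simp add: frechet_derivative_works)
  then have "((\<lambda>x. f (t, x)) has_derivative (\<lambda>v. frechet_derivative f (at (t, x)) (0, v))) (at x)"
    by (rule has_derivative_compose[rotated]) (auto intro!: derivative_eq_intros)
  then show ?thesis .
qed

lemma smooth_on_slice:
  assumes "smooth_on (UNIV \<times> D) f" "open D"
  shows "smooth_on D (\<lambda>x. f (t, x))"
proof -
  have op: "open (UNIV \<times> D)" using assms(2) by (simp add: open_Times)
  have "Ck_on k D (\<lambda>x. f (t, x))" if "Ck_on k (UNIV \<times> D) f" for k
    using that
  proof (induction k arbitrary: f)
    case 0
    then show ?case by (auto intro!: continuous_on_compose2[of "UNIV \<times> D" f] continuous_intros)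
  next
    case (Suc k)
    have d: "((\<lambda>x. f (t, x)) has_derivative (\<lambda>v. frechet_derivative f (at (t, x)) (0, v))) (at x)"
      if "x \<in> D" for x
      using Suc.prems that unfolding Ck_on_Suc_open[OF op] by (intro has_derivative_slice) auto
    have "Ck_on k D (\<lambda>x. frechet_derivative (\<lambda>x. f (t, x)) (at x) v)" for v
    proof (rule Ck_on_cong)
      show "Ck_on k D (\<lambda>x. frechet_derivative f (at (t, x)) (0, v))"
        using Suc.IH Suc.prems unfolding Ck_on_Suc_open[OF op] by blast
      show "frechet_derivative f (at (t, x)) (0, v) = frechet_derivative (\<lambda>x. f (t, x)) (at x) v"
        if "x \<in> D" for x
        using frechet_derivative_at[OF d[OF that]] by metis
    qed
    then show ?case
      unfolding Ck_on_Suc_open[OF assms(2)] using d by (auto simp: differentiable_def)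
  qed
  then show ?thesis using assms(1) unfolding smooth_on_def by blast
qed

lemma has_vector_derivative_time:
  assumes "f differentiable at (t, x)"
  shows "((\<lambda>s. f (s, x)) has_vector_derivative frechet_derivative f (at (t, x)) (1, 0)) (at t)"
proof -
  have "(f has_derivative frechet_derivative f (at (t, x))) (at (t, x))"
    using assms by (simp add: frechet_derivative_works)
  then have d: "((\<lambda>s. f (s, x)) has_derivative (\<lambda>h. frechet_derivative f (at (t, x)) (h, 0))) (at t)"
    by (rule has_derivative_compose[rotated]) (auto intro!: derivative_eq_intros)
  interpret linear "frechet_derivative f (at (t, x))"
    using assms by (rule linear_frechet_derivative)
  have "frechet_derivative f (at (t, x)) (h, 0) = h *\<^sub>R frechet_derivative f (at (t, x)) (1, 0)" for h
    using scale[of h "(1, 0)"] by simp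
  then show ?thesis
    unfolding has_vector_derivative_def by (intro has_derivative_eq_rhs[OF d] ext)
qed

section \<open>Taylor expansion along a polynomial curve\<close>

lemma frechet_nth_replicate_Suc:
  "frechet_nth f (replicate (Suc b) v) =
    frechet_nth (\<lambda>x. frechet_derivative f (at x) v) (replicate b v)"
proof -
  have "frechet_nth f [v] = (\<lambda>x. frechet_derivative f (at x) v)"
    by (intro ext) (simp add: eta_contract_eq)
  then show ?thesis
    using frechet_nth_append[of f "replicate b v" "[v]"] by (simp add: replicate_append_same)
qed

text \<open>
  The remainder of order $p + 1$ vanishes at $s = 0$, and its derivative in $s$ is the remainder of
  order $p$ of the directional derivative of $f$, so integrating the bound on the latter raises the
  exponent by one. The point $x$ is arbitrary in the convex set because the lemma is applied at base
  points that move with the parameter.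
\<close>

lemma directional_taylor_bound:
  fixes f :: "'a::euclidean_space \<Rightarrow> 'b::euclidean_space"
  assumes "smooth_on D f" "open D" "convex K" "K \<subseteq> D"
    and "\<And>y. y \<in> K \<Longrightarrow> norm (frechet_nth f (replicate p v) y) \<le> M"
    and "x \<in> K" "x + s *\<^sub>R v \<in> K"
  shows "norm (f (x + s *\<^sub>R v) - (\<Sum>b<p. (s ^ b / fact b) *\<^sub>R frechet_nth f (replicate b v) x))
    \<le> M * \<bar>s\<bar> ^ p"
  using assms(1,5,7)
proof (induction p arbitrary: f s)
  case 0
  from "0.prems"(2)[OF "0.prems"(3)] show ?case by simp
next
  case (Suc p)
  define f' where "f' = (\<lambda>x. frechet_derivative f (at x) v)"
  define h where "h \<sigma> = f (x + \<sigma> *\<^sub>R v) -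
    (\<Sum>b<Suc p. (\<sigma> ^ b / fact b) *\<^sub>R frechet_nth f (replicate b v) x)" for \<sigma>
  define h' where "h' \<sigma> = f' (x + \<sigma> *\<^sub>R v) -
    (\<Sum>b<p. (\<sigma> ^ b / fact b) *\<^sub>R frechet_nth f' (replicate b v) x)" for \<sigma>
  have smooth': "smooth_on D f'"
    unfolding f'_def using Suc.prems(1) assms(2) by (rule smooth_on_frechet_derivative)
  have M: "norm (frechet_nth f' (replicate p v) y) \<le> M" if "y \<in> K" for y
    using Suc.prems(2)[OF that] unfolding f'_def frechet_nth_replicate_Suc .
  have "0 \<le> M" using order_trans[OF norm_ge_zero M[OF assms(6)]] .
  have inK: "x + \<sigma> *\<^sub>R v \<in> K" if \<sigma>: "\<sigma> \<in> closed_segment 0 s" for \<sigma>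
  proof -
    obtain u where u: "0 \<le> u" "u \<le> 1" "\<sigma> = u * s"
      using \<sigma> by (auto simp: in_segment)
    have "x + \<sigma> *\<^sub>R v = (1 - u) *\<^sub>R x + u *\<^sub>R (x + s *\<^sub>R v)"
      unfolding u(3) by (simp add: algebra_simps)
    then show ?thesis
      using convexD_alt[OF assms(3,6) Suc.prems(3) u(1,2)] by simp
  qed
  have deriv: "(h has_derivative (\<lambda>r. r *\<^sub>R h' \<sigma>)) (at \<sigma> within closed_segment 0 s)"
    if \<sigma>: "\<sigma> \<in> closed_segment 0 s" for \<sigma>
  proof -
    have "f differentiable at (x + \<sigma> *\<^sub>R v)"
      using smooth_on_differentiable[OF Suc.prems(1) assms(2)] inK[OF \<sigma>] assms(4) by blast
    then have fd: "(f has_derivative frechet_derivative f (at (x + \<sigma> *\<^sub>R v))) (at (x + \<sigma> *\<^sub>R v))"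
      and lin: "linear (frechet_derivative f (at (x + \<sigma> *\<^sub>R v)))"
      by (simp_all add: frechet_derivative_works linear_frechet_derivative)
    from fd have "((\<lambda>\<sigma>. f (x + \<sigma> *\<^sub>R v)) has_derivative
        (\<lambda>r. frechet_derivative f (at (x + \<sigma> *\<^sub>R v)) (r *\<^sub>R v))) (at \<sigma>)"
      by (rule has_derivative_compose[rotated]) (auto intro!: derivative_eq_intros)
    then have 1: "((\<lambda>\<sigma>. f (x + \<sigma> *\<^sub>R v)) has_vector_derivative f' (x + \<sigma> *\<^sub>R v)) (at \<sigma>)"
      unfolding has_vector_derivative_def f'_def linear_scale[OF lin] .
    have pow: "((\<lambda>\<sigma>. \<sigma> ^ Suc b / fact (Suc b)) has_real_derivative \<sigma> ^ b / fact b) (at \<sigma>)" for b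
    proof -
      have "((\<lambda>\<sigma>. \<sigma> ^ Suc b / fact (Suc b)) has_real_derivative
          (real (Suc b) * \<sigma> ^ b) / fact (Suc b)) (at \<sigma>)"
        by (rule DERIV_cdivide) (use DERIV_pow[of "Suc b" \<sigma> UNIV] in \<open>simp del: power_Suc of_nat_Suc\<close>)
      moreover have "(real (Suc b) * \<sigma> ^ b) / fact (Suc b) = \<sigma> ^ b / fact b"
        by (simp add: field_simps del: of_nat_Suc)
      ultimately show ?thesis by simp
    qed
    have "((\<lambda>\<sigma>. \<Sum>b<p. (\<sigma> ^ Suc b / fact (Suc b)) *\<^sub>R frechet_nth f (replicate (Suc b) v) x)
        has_vector_derivative (\<Sum>b<p. (\<sigma> ^ b / fact b) *\<^sub>R frechet_nth f' (replicate b v) x)) (at \<sigma>)"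
      unfolding f'_def frechet_nth_replicate_Suc
      by (intro has_vector_derivative_sum)
         (use has_vector_derivative_scaleR[OF pow has_vector_derivative_const] in simp)
    then have "((\<lambda>\<sigma>. \<Sum>b<Suc p. (\<sigma> ^ b / fact b) *\<^sub>R frechet_nth f (replicate b v) x)
        has_vector_derivative (\<Sum>b<p. (\<sigma> ^ b / fact b) *\<^sub>R frechet_nth f' (replicate b v) x)) (at \<sigma>)"
      unfolding sum.lessThan_Suc_shift
      using has_vector_derivative_add[OF has_vector_derivative_const] by fastforce
    from has_vector_derivative_diff[OF 1 this] have "(h has_vector_derivative h' \<sigma>) (at \<sigma>)"
      unfolding h_def h'_def .
    then show ?thesis
      unfolding has_vector_derivative_def by (rule has_derivative_at_withinI)
  qed
  have bound: "onorm (\<lambda>r. r *\<^sub>R h' \<sigma>) \<le> M * \<bar>s\<bar> ^ p" if \<sigma>: "\<sigma> \<in> closed_segment 0 s" for \<sigma>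
  proof (rule onorm_le)
    have "norm (h' \<sigma>) \<le> M * \<bar>\<sigma>\<bar> ^ p"
      unfolding h'_def by (rule Suc.IH[OF smooth' M inK[OF \<sigma>]])
    also have "\<dots> \<le> M * \<bar>s\<bar> ^ p"
      using \<sigma> \<open>0 \<le> M\<close>
      by (intro mult_left_mono power_mono) (auto simp: closed_segment_eq_real_ivl split: if_splits)
    finally show "norm (r *\<^sub>R h' \<sigma>) \<le> M * \<bar>s\<bar> ^ p * norm r" for r
      by (simp add: mult.commute[of _ "\<bar>r\<bar>"] mult_left_mono)
  qed
  have "norm (h s - h 0) \<le> M * \<bar>s\<bar> ^ p * norm (s - 0)"
    by (rule differentiable_bound[OF convex_closed_segment deriv bound]) auto
  moreover have "h 0 = 0"
    unfolding h_def sum.lessThan_Suc_shift by simp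
  ultimately show ?case unfolding h_def by (simp add: mult_ac)
qed

text \<open>
  The points $X(\varepsilon)$ and $X(\varepsilon) + s(\varepsilon) v$ eventually lie in a closed ball about
  $z$ inside $D$; its compactness bounds the derivative of order $p$, uniformly in $\varepsilon$.
\<close>

lemma directional_taylor_order:
  fixes f :: "'a::euclidean_space \<Rightarrow> 'b::euclidean_space"
  assumes "smooth_on D f" "open D" "z \<in> D"
    and X: "(X \<longlongrightarrow> z) (at 0)" and s: "\<forall>\<^sub>F \<epsilon> in at 0. \<bar>s \<epsilon>\<bar> \<le> \<bar>\<epsilon>\<bar>"
  shows "vanishes_to_order p (\<lambda>\<epsilon>. f (X \<epsilon> + s \<epsilon> *\<^sub>R v) -
    (\<Sum>b<p. (s \<epsilon> ^ b / fact b) *\<^sub>R frechet_nth f (replicate b v) (X \<epsilon>)))"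
proof -
  obtain r where r: "r > 0" "cball z r \<subseteq> D"
    using assms(2,3) open_contains_cball by blast
  have "compact (frechet_nth f (replicate p v) ` cball z r)"
    using smooth_on_continuous_on[OF smooth_on_frechet_nth[OF assms(1,2)]] r(2)
    by (intro compact_continuous_image compact_cball) (auto intro: continuous_on_subset)
  then obtain M where M: "norm (frechet_nth f (replicate p v) y) \<le> M" if "y \<in> cball z r" for y
    by (meson bounded_iff compact_imp_bounded imageI)
  have "0 \<le> M" using order_trans[OF norm_ge_zero M[of z]] r by simp
  have "(s \<longlongrightarrow> 0) (at 0)"
    by (rule tendsto_rabs_zero_cancel, rule tendsto_sandwich[OF _ s])
       (auto intro!: tendsto_eq_intros)
  then have "((\<lambda>\<epsilon>. X \<epsilon> + s \<epsilon> *\<^sub>R v) \<longlongrightarrow> z) (at 0)"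
    using X by (auto intro!: tendsto_eq_intros)
  then have "\<forall>\<^sub>F \<epsilon> in at 0. dist (X \<epsilon> + s \<epsilon> *\<^sub>R v) z < r" "\<forall>\<^sub>F \<epsilon> in at 0. dist (X \<epsilon>) z < r"
    using X r(1) by (auto dest: tendstoD)
  with s have "\<forall>\<^sub>F \<epsilon> in at 0. norm (f (X \<epsilon> + s \<epsilon> *\<^sub>R v) -
    (\<Sum>b<p. (s \<epsilon> ^ b / fact b) *\<^sub>R frechet_nth f (replicate b v) (X \<epsilon>))) \<le> M * \<bar>\<epsilon>\<bar> ^ p"
  proof eventually_elim
    case (elim \<epsilon>)
    have "norm (f (X \<epsilon> + s \<epsilon> *\<^sub>R v) -
      (\<Sum>b<p. (s \<epsilon> ^ b / fact b) *\<^sub>R frechet_nth f (replicate b v) (X \<epsilon>))) \<le> M * \<bar>s \<epsilon>\<bar> ^ p"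
      by (rule directional_taylor_bound[OF assms(1,2) convex_cball r(2) M])
         (use elim in \<open>auto simp: dist_commute\<close>)
    also have "\<dots> \<le> M * \<bar>\<epsilon>\<bar> ^ p"
      using elim \<open>0 \<le> M\<close> by (intro mult_left_mono power_mono) auto
    finally show ?case .
  qed
  then show ?thesis unfolding vanishes_to_order_def by blast
qed

text \<open>
  Exponent tuples $(b_1, \ldots, b_N)$, encoded as in \<open>bell_tuples\<close> by functions vanishing
  elsewhere. A box is convenient because it grows by one factor with each new variable; exponents of
  size \<open>p\<close> or more only produce terms that vanish to order \<open>p\<close>.
\<close>

definition multi_indices :: "nat \<Rightarrow> nat \<Rightarrow> (nat \<Rightarrow> nat) set" where
  "multi_indices N p = {b. (\<forall>j\<in>{1..N}. b j < p) \<and> (\<forall>j. j \<notin> {1..N} \<longrightarrow> b j = 0)}"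

lemma finite_multi_indices: "finite (multi_indices N p)"
proof (rule finite_subset)
  show "multi_indices N p \<subseteq> {b. \<forall>j. (j \<in> {1..N} \<longrightarrow> b j \<in> {..<p}) \<and> (j \<notin> {1..N} \<longrightarrow> b j = 0)}"
    by (auto simp: multi_indices_def)
  show "finite {b. \<forall>j. (j \<in> {1..N} \<longrightarrow> b j \<in> {..<p}) \<and> (j \<notin> {1..N} \<longrightarrow> b j = 0)}"
    by (rule finite_set_of_finite_funs) auto
qed

text \<open>
  The argument list that represents the monomial $v_1^{b_1} \cdots v_N^{b_N}$.
\<close>

definition repeat_each :: "nat \<Rightarrow> (nat \<Rightarrow> nat) \<Rightarrow> (nat \<Rightarrow> 'a) \<Rightarrow> 'a list" where
  "repeat_each N b v = concat (map (\<lambda>j. replicate (b j) (v j)) [1..<Suc N])"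

lemma repeat_each_0 [simp]: "repeat_each 0 b v = []"
  by (simp add: repeat_each_def)

lemma repeat_each_Suc:
  "repeat_each (Suc N) b v = repeat_each N b v @ replicate (b (Suc N)) (v (Suc N))"
  by (simp add: repeat_each_def)

lemma repeat_each_zero: "repeat_each N (\<lambda>_. 0) v = []"
  by (induction N) (simp_all add: repeat_each_Suc)

lemma repeat_each_cong:
  assumes "\<And>j. 1 \<le> j \<Longrightarrow> j \<le> N \<Longrightarrow> b j = b' j"
  shows "repeat_each N b v = repeat_each N b' v"
  unfolding repeat_each_def by (rule arg_cong[where f = concat], rule map_cong) (use assms in auto)

lemma sum_multi_indices_Suc:
  "(\<Sum>b\<in>multi_indices (Suc N) p. G b) =
    (\<Sum>a<p. \<Sum>b\<in>multi_indices N p. G (b(Suc N := a)))"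
proof -
  have "(\<Sum>b\<in>multi_indices (Suc N) p. G b) =
      (\<Sum>(a, b)\<in>{..<p} \<times> multi_indices N p. G (b(Suc N := a)))"
    by (rule sum.reindex_bij_witness[of _ "\<lambda>(a, b). b(Suc N := a)" "\<lambda>b. (b (Suc N), b(Suc N := 0))"])
       (auto simp: multi_indices_def fun_eq_iff)
  then show ?thesis by (simp add: sum.cartesian_product)
qed

text \<open>
  The displacement is added one vector at a time: with the first $N$ terms as a moving base point, the
  last term is handled by the one-directional Taylor formula, and the induction hypothesis is applied
  to the derivatives $\partial_{v_{N+1}}^a f$. This differentiates along the last vector first, which is
  the order that \<open>frechet_nth\<close> prescribes for the list \<open>repeat_each\<close>.
\<close>

lemma taylor_along_curve:
  fixes f :: "'a::euclidean_space \<Rightarrow> 'b::euclidean_space"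
  assumes "smooth_on D f" "open D" "z \<in> D"
  shows "vanishes_to_order p (\<lambda>\<epsilon>. f (z + (\<Sum>j=1..N. (\<epsilon> ^ j / fact j) *\<^sub>R v j)) -
    (\<Sum>b\<in>multi_indices N p. (\<Prod>j=1..N. (\<epsilon> ^ j / fact j) ^ b j / fact (b j)) *\<^sub>R
       frechet_nth f (repeat_each N b v) z))"
  using assms(1)
proof (induction N arbitrary: f)
  case 0
  have "multi_indices 0 p = {\<lambda>_. 0}" by (auto simp: multi_indices_def)
  then show ?case by simp
next
  case (Suc N)
  define X where "X \<epsilon> = z + (\<Sum>j=1..N. (\<epsilon> ^ j / fact j) *\<^sub>R v j)" for \<epsilon> :: real
  define s where "s \<epsilon> = \<epsilon> ^ Suc N / fact (Suc N)" for \<epsilon> :: real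
  define c where "c \<epsilon> b = (\<Prod>j=1..N. (\<epsilon> ^ j / fact j) ^ b j / fact (b j))" for \<epsilon> :: real and b :: "nat \<Rightarrow> nat"
  define f' where "f' a = frechet_nth f (replicate a (v (Suc N)))" for a
  have X: "(X \<longlongrightarrow> z) (at 0)"
    unfolding X_def by (auto intro!: tendsto_eq_intros sum.neutral)
  have s0: "(s \<longlongrightarrow> 0) (at 0)"
    unfolding s_def by (auto intro!: tendsto_eq_intros)
  have "\<forall>\<^sub>F \<epsilon> in at (0::real). \<bar>\<epsilon>\<bar> \<le> 1"
    unfolding eventually_at by (rule exI[of _ 1]) (auto simp: dist_real_def)
  then have s: "\<forall>\<^sub>F \<epsilon> in at 0. \<bar>s \<epsilon>\<bar> \<le> \<bar>\<epsilon>\<bar>"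
  proof eventually_elim
    case (elim \<epsilon>)
    have "\<bar>s \<epsilon>\<bar> \<le> \<bar>\<epsilon>\<bar> ^ Suc N / 1"
      unfolding s_def abs_divide power_abs abs_of_pos[OF fact_gt_zero]
      by (rule divide_left_mono) (use fact_ge_1[of "Suc N", where ?'a = real] in auto)
    also have "\<dots> \<le> \<bar>\<epsilon>\<bar>" using power_decreasing[of 1 "Suc N" "\<bar>\<epsilon>\<bar>"] elim by simp
    finally show ?case .
  qed
  \<comment> \<open>The error splits into that of expanding \<open>f\<close> about \<open>X \<epsilon>\<close> and those of expanding its coefficients.\<close>
  have "vanishes_to_order p (\<lambda>\<epsilon>. (f (X \<epsilon> + s \<epsilon> *\<^sub>R v (Suc N)) - (\<Sum>a<p. (s \<epsilon> ^ a / fact a) *\<^sub>R f' a (X \<epsilon>)))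
    + (\<Sum>a<p. (s \<epsilon> ^ a / fact a) *\<^sub>R (f' a (X \<epsilon>) -
        (\<Sum>b\<in>multi_indices N p. c \<epsilon> b *\<^sub>R frechet_nth (f' a) (repeat_each N b v) z))))"
  proof (intro vanishes_to_order_add vanishes_to_order_sum)
    show "vanishes_to_order p (\<lambda>\<epsilon>. f (X \<epsilon> + s \<epsilon> *\<^sub>R v (Suc N)) -
        (\<Sum>a<p. (s \<epsilon> ^ a / fact a) *\<^sub>R f' a (X \<epsilon>)))"
      unfolding f'_def by (rule directional_taylor_order[OF Suc.prems assms(2,3) X s])
    show "vanishes_to_order p (\<lambda>\<epsilon>. (s \<epsilon> ^ a / fact a) *\<^sub>R (f' a (X \<epsilon>) -
        (\<Sum>b\<in>multi_indices N p. c \<epsilon> b *\<^sub>R frechet_nth (f' a) (repeat_each N b v) z)))" for a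
    proof -
      have "vanishes_to_order 0 (\<lambda>\<epsilon>. s \<epsilon> ^ a / fact a)"
        by (rule vanishes_to_order_tendsto[where L = "0 ^ a / fact a"]) (intro tendsto_intros s0, simp)
      moreover have "vanishes_to_order p (\<lambda>\<epsilon>. f' a (X \<epsilon>) -
          (\<Sum>b\<in>multi_indices N p. c \<epsilon> b *\<^sub>R frechet_nth (f' a) (repeat_each N b v) z))"
        unfolding X_def c_def
        by (rule Suc.IH) (simp add: f'_def smooth_on_frechet_nth[OF Suc.prems assms(2)])
      ultimately show ?thesis using vanishes_to_order_scaleR by fastforce
    qed
  qed
  moreover have "(f (X \<epsilon> + s \<epsilon> *\<^sub>R v (Suc N)) - (\<Sum>a<p. (s \<epsilon> ^ a / fact a) *\<^sub>R f' a (X \<epsilon>)))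
    + (\<Sum>a<p. (s \<epsilon> ^ a / fact a) *\<^sub>R (f' a (X \<epsilon>) -
        (\<Sum>b\<in>multi_indices N p. c \<epsilon> b *\<^sub>R frechet_nth (f' a) (repeat_each N b v) z)))
    = f (z + (\<Sum>j=1..Suc N. (\<epsilon> ^ j / fact j) *\<^sub>R v j)) -
    (\<Sum>b\<in>multi_indices (Suc N) p. (\<Prod>j=1..Suc N. (\<epsilon> ^ j / fact j) ^ b j / fact (b j)) *\<^sub>R
       frechet_nth f (repeat_each (Suc N) b v) z)" for \<epsilon>
  proof -
    have "(\<Prod>j=1..Suc N. (\<epsilon> ^ j / fact j) ^ (b(Suc N := a)) j / fact ((b(Suc N := a)) j)) =
        c \<epsilon> b * (s \<epsilon> ^ a / fact a)" for a b
    proof -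
      have "(\<Prod>j=1..N. (\<epsilon> ^ j / fact j) ^ (b(Suc N := a)) j / fact ((b(Suc N := a)) j)) = c \<epsilon> b"
        unfolding c_def by (rule prod.cong) auto
      then show ?thesis by (simp add: s_def)
    qed
    moreover have "frechet_nth f (repeat_each (Suc N) (b(Suc N := a)) v)
        = frechet_nth (f' a) (repeat_each N b v)" for a b
    proof -
      have "repeat_each N (b(Suc N := a)) v = repeat_each N b v" by (rule repeat_each_cong) simp
      then show ?thesis by (simp add: repeat_each_Suc f'_def frechet_nth_append)
    qed
    moreover have "z + (\<Sum>j=1..Suc N. (\<epsilon> ^ j / fact j) *\<^sub>R v j) = X \<epsilon> + s \<epsilon> *\<^sub>R v (Suc N)"
      by (simp add: X_def s_def add.assoc)
    ultimately show ?thesis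
      unfolding sum_multi_indices_Suc
      by (simp add: scaleR_diff_right sum_subtractf scaleR_sum_right mult.commute)
  qed
  ultimately show ?case by simp
qed

section \<open>The expansion in terms of Bell polynomials\<close>

text \<open>
  Subtracting $\sum_j b_j = m$ from $\sum_j j b_j = q$ leaves $\sum_j (j-1) b_j = q - m$, and a tuple
  with $b_i \neq 0$ contributes at least $i - 1$ to this sum. This is why a Bell polynomial $B_{q,m}$
  involves the first $q - m + 1$ variables only.
\<close>

lemma bell_tuples_support:
  fixes b :: "nat \<Rightarrow> nat"
  assumes "(\<Sum>j=1..N. j * b j) = q" "(\<Sum>j=1..N. b j) = m" "i \<in> {1..N}" "b i \<noteq> 0"
  shows "i \<le> q - m + 1"
proof -
  have "(\<Sum>j=1..N. j * b j) = (\<Sum>j=1..N. b j + (j - 1) * b j)"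
  proof (rule sum.cong)
    show "j * b j = b j + (j - 1) * b j" if "j \<in> {1..N}" for j
      using that by (cases j) auto
  qed simp
  then have "q = m + (\<Sum>j=1..N. (j - 1) * b j)"
    using assms(1,2) by (simp add: sum.distrib)
  moreover have "(i - 1) * b i \<le> (\<Sum>j=1..N. (j - 1) * b j)"
    using assms(3) by (intro member_le_sum) auto
  moreover have "i - 1 \<le> (i - 1) * b i" using assms(4) by simp
  ultimately show ?thesis by linarith
qed

lemma sum_bell_tuples_extend:
  assumes b: "b \<in> bell_tuples q m" and "1 \<le> m" "m \<le> q" "q \<le> N"
  shows "(\<Sum>j=1..N. b j) = m" "(\<Sum>j=1..N. j * b j) = q"
proof -
  have sub: "{1..q - m + 1} \<subseteq> {1..N}" using assms by auto
  have "(\<Sum>j=1..N. b j) = (\<Sum>j=1..q - m + 1. b j)"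
    "(\<Sum>j=1..N. j * b j) = (\<Sum>j=1..q - m + 1. j * b j)"
    by (rule sum.mono_neutral_right[OF _ sub]; use b in \<open>auto simp: bell_tuples_def\<close>)+
  with b show "(\<Sum>j=1..N. b j) = m" "(\<Sum>j=1..N. j * b j) = q"
    by (auto simp: bell_tuples_def)
qed

text \<open>
  The terms of $\varepsilon$-degree $q$ in the Taylor expansion are sorted by the order
  $m = \sum_j b_j$ of the derivative.
\<close>

lemma multi_indices_eq_Union_bell_tuples:
  assumes "1 \<le> q" "q < p" "q \<le> N"
  shows "{b \<in> multi_indices N p. (\<Sum>j=1..N. j * b j) = q} = (\<Union>m\<in>{1..q}. bell_tuples q m)"
proof (intro equalityI subsetI)
  fix b assume "b \<in> {b \<in> multi_indices N p. (\<Sum>j=1..N. j * b j) = q}"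
  then have b: "\<And>j. j \<notin> {1..N} \<Longrightarrow> b j = 0" "(\<Sum>j=1..N. j * b j) = q"
    by (auto simp: multi_indices_def)
  define m where "m = (\<Sum>j=1..N. b j)"
  have "m \<le> q" unfolding m_def b(2)[symmetric] by (rule sum_mono) auto
  moreover have "m \<noteq> 0"
  proof
    assume "m = 0"
    then have "(\<Sum>j=1..N. j * b j) = 0" by (simp add: m_def)
    with b(2) assms(1) show False by simp
  qed
  moreover have supp: "b j = 0" if "j \<notin> {1..q - m + 1}" for j
    using bell_tuples_support[OF b(2) m_def[symmetric], of j] b(1)[of j] that by force
  have sub: "{1..q - m + 1} \<subseteq> {1..N}" using assms \<open>m \<noteq> 0\<close> by auto
  have "m = (\<Sum>j=1..q - m + 1. b j)" "(\<Sum>j=1..N. j * b j) = (\<Sum>j=1..q - m + 1. j * b j)"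
    by (rule trans[OF m_def sum.mono_neutral_right[OF _ sub]]
          sum.mono_neutral_right[OF _ sub]; use supp in auto)+
  then have "b \<in> bell_tuples q m"
    using b(2) supp unfolding bell_tuples_def by (intro CollectI conjI allI impI) metis+
  ultimately show "b \<in> (\<Union>m\<in>{1..q}. bell_tuples q m)" by force
next
  fix b assume "b \<in> (\<Union>m\<in>{1..q}. bell_tuples q m)"
  then obtain m where m: "1 \<le> m" "m \<le> q" and b: "b \<in> bell_tuples q m" by auto
  note sums = sum_bell_tuples_extend[OF b m assms(3)]
  have "b j < p" if "j \<in> {1..N}" for j
  proof -
    have "b j \<le> j * b j" using that by simp
    also have "\<dots> \<le> q" unfolding sums(2)[symmetric] using that by (intro member_le_sum) auto
    finally show ?thesis using assms by simp
  qed
  moreover have "b j = 0" if "j \<notin> {1..N}" for j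
    using b that m assms by (auto simp: bell_tuples_def)
  ultimately show "b \<in> {b \<in> multi_indices N p. (\<Sum>j=1..N. j * b j) = q}"
    using sums(2) by (simp add: multi_indices_def)
qed

text \<open>
  The variables beyond $q - m + 1$ carry exponent $0$, so products and lists can be taken over all
  of $1, \ldots, N$, uniformly in $m$.
\<close>

lemma bell_apply_eq_sum:
  assumes "1 \<le> m" "m \<le> q" "q \<le> N"
  shows "bell_apply q m L v = fact q *\<^sub>R (\<Sum>b\<in>bell_tuples q m.
    (\<Prod>j=1..N. (1 / fact j) ^ b j / fact (b j)) *\<^sub>R L (repeat_each N b v))"
  unfolding bell_apply_def scaleR_sum_right scaleR_scaleR
proof (rule sum.cong[OF refl])
  fix b assume b: "b \<in> bell_tuples q m"
  have sub: "{1..q - m + 1} \<subseteq> {1..N}" using assms by auto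
  have supp: "b j = 0" if "j \<notin> {1..q - m + 1}" for j
    using b that by (auto simp: bell_tuples_def)
  have "(\<Prod>j=1..N. (1 / fact j) ^ b j / fact (b j)) =
      (\<Prod>j=1..q - m + 1. (1 / fact j) ^ b j / fact (b j) :: real)"
    using sub by (intro prod.mono_neutral_right) (auto simp: supp)
  then have coeff: "fact q / (\<Prod>j=1..q - m + 1. fact (b j)) * (\<Prod>j=1..q - m + 1. (1 / fact j) ^ b j)
      = fact q * (\<Prod>j=1..N. (1 / fact j) ^ b j / fact (b j) :: real)"
    by (simp add: prod_dividef)
  have "[1..<Suc N] = [1..<q - m + 2] @ [q - m + 2..<Suc N]"
    using upt_add_eq_append[of 1 "q - m + 2" "Suc N - (q - m + 2)"] assms by simp
  moreover have "concat (map (\<lambda>j. replicate (b j) (v j)) [q - m + 2..<Suc N]) = []"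
    using supp by auto
  ultimately have "repeat_each N b v = concat (map (\<lambda>j. replicate (b j) (v j)) [1..<q - m + 2])"
    unfolding repeat_each_def by simp
  with coeff show "(fact q / (\<Prod>j=1..q - m + 1. fact (b j)) * (\<Prod>j=1..q - m + 1. (1 / fact j) ^ b j)) *\<^sub>R
      L (concat (map (\<lambda>j. replicate (b j) (v j)) [1..<q - m + 2])) =
    (fact q * (\<Prod>j=1..N. (1 / fact j) ^ b j / fact (b j))) *\<^sub>R L (repeat_each N b v)"
    by simp
qed

text \<open>
  The coefficient of $\varepsilon^q$ in $f(z + \sum_j \varepsilon^j v_j / j!)$ according to the formula
  of Faa di Bruno, by which the Melnikov integrands are defined.
\<close>

definition faa_di_bruno_coeff ::
  "('a::euclidean_space \<Rightarrow> 'b::euclidean_space) \<Rightarrow> 'a \<Rightarrow> (nat \<Rightarrow> 'a) \<Rightarrow> nat \<Rightarrow> 'b" where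
  "faa_di_bruno_coeff f z v q = (if q = 0 then f z else
     (\<Sum>m=1..q. bell_apply q m (\<lambda>vs. frechet_nth f vs z) v) /\<^sub>R fact q)"

text \<open>
  With increments written as $\varepsilon^j v_j / j!$ the weights of the Taylor formula
  become exactly those of the Bell polynomials, up to the factor $q!$. The bound on \<open>p\<close> is
  needed because the coefficient of $\varepsilon^q$ involves $v_1, \ldots, v_q$, of which the curve only
  contains the first $N$.
\<close>

lemma faa_di_bruno_expands:
  fixes f :: "'a::euclidean_space \<Rightarrow> 'b::euclidean_space"
  assumes "smooth_on D f" "open D" "z \<in> D" "p \<le> Suc N"
  shows "expands p (\<lambda>\<epsilon>. f (z + (\<Sum>j=1..N. (\<epsilon> ^ j / fact j) *\<^sub>R v j))) (faa_di_bruno_coeff f z v)"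
proof -
  define wt where "wt b = (\<Sum>j=1..N. j * b j)" for b :: "nat \<Rightarrow> nat"
  define A where "A b = (\<Prod>j=1..N. (1 / fact j) ^ b j / fact (b j)) *\<^sub>R
    frechet_nth f (repeat_each N b v) z" for b
  have monomial: "(\<Prod>j=1..N. (\<epsilon> ^ j / fact j) ^ b j / fact (b j)) *\<^sub>R frechet_nth f (repeat_each N b v) z
      = \<epsilon> ^ wt b *\<^sub>R A b" for \<epsilon> :: real and b
  proof -
    have "(\<Prod>j=1..N. (\<epsilon> ^ j / fact j) ^ b j / fact (b j)) =
        (\<Prod>j=1..N. \<epsilon> ^ (j * b j)) * (\<Prod>j=1..N. (1 / fact j) ^ b j / fact (b j))"
      unfolding prod.distrib[symmetric]
      by (rule prod.cong) (auto simp: power_divide power_mult)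
    then show ?thesis by (simp add: A_def wt_def power_sum)
  qed
  have "vanishes_to_order p (\<lambda>\<epsilon>. f (z + (\<Sum>j=1..N. (\<epsilon> ^ j / fact j) *\<^sub>R v j)) -
      (\<Sum>b\<in>multi_indices N p. \<epsilon> ^ wt b *\<^sub>R A b))"
    using taylor_along_curve[OF assms(1-3), where p = p and N = N and v = v] unfolding monomial .
  from expands_add[OF expands_vanishing[OF this] expands_sum[where I = "multi_indices N p" and
        \<phi> = "\<lambda>b \<epsilon>. \<epsilon> ^ wt b *\<^sub>R A b", OF expands_monomial]]
  have "expands p (\<lambda>\<epsilon>. f (z + (\<Sum>j=1..N. (\<epsilon> ^ j / fact j) *\<^sub>R v j)))
      (\<lambda>q. \<Sum>b\<in>multi_indices N p. if q = wt b then A b else 0)"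
    by simp
  then show ?thesis
  proof (rule expands_coeff_cong)
    fix q assume q: "q < p"
    have "(\<Sum>b\<in>multi_indices N p. if q = wt b then A b else 0) = (\<Sum>b\<in>{b \<in> multi_indices N p. wt b = q}. A b)"
      by (rule sum.mono_neutral_cong_right) (auto simp: finite_multi_indices)
    also have "\<dots> = faa_di_bruno_coeff f z v q"
    proof (cases "q = 0")
      case True
      have "{b \<in> multi_indices N p. wt b = q} = {\<lambda>_. 0}"
        using q True by (force simp: multi_indices_def wt_def fun_eq_iff)
      then show ?thesis
        using True repeat_each_zero[of N v] by (simp add: A_def faa_di_bruno_coeff_def)
    next
      case False
      have disjoint: "bell_tuples q m \<inter> bell_tuples q m' = {}"
        if "m \<in> {1..q}" "m' \<in> {1..q}" "m \<noteq> m'" for m m'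
      proof (rule equals0I)
        fix b assume "b \<in> bell_tuples q m \<inter> bell_tuples q m'"
        then show False
          using sum_bell_tuples_extend(1)[of b q m q] sum_bell_tuples_extend(1)[of b q m' q] that
          by simp
      qed
      have "(\<Sum>b\<in>{b \<in> multi_indices N p. wt b = q}. A b) = (\<Sum>b\<in>(\<Union>m\<in>{1..q}. bell_tuples q m). A b)"
        using multi_indices_eq_Union_bell_tuples[of q p N] False q assms(4) by (simp add: wt_def)
      also have "\<dots> = (\<Sum>m=1..q. \<Sum>b\<in>bell_tuples q m. A b)"
        by (intro sum.UNION_disjoint) (use disjoint in \<open>auto simp: finite_bell_tuples\<close>)
      also have "\<dots> = (\<Sum>m=1..q. bell_apply q m (\<lambda>vs. frechet_nth f vs z) v /\<^sub>R fact q)"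
        by (rule sum.cong) (use q assms(4) in \<open>auto simp: A_def bell_apply_eq_sum[of _ q N]\<close>)
      finally show ?thesis
        using False by (simp add: faa_di_bruno_coeff_def scaleR_sum_right)
    qed
    finally show "(\<Sum>b\<in>multi_indices N p. if q = wt b then A b else 0) = faa_di_bruno_coeff f z v q" .
  qed
qed

section \<open>Melnikov functions and stroboscopic averaged functions\<close>

text \<open>
  The closed parameter interval contains a neighbourhood of $0$, so the remainder is continuous at
  $(t, z, 0)$ as a function on the whole space and hence bounded nearby.
\<close>

lemma vanishes_to_order_0_along_parameter:
  fixes R :: "real \<Rightarrow> 'a::real_normed_vector \<Rightarrow> real \<Rightarrow> 'b::real_normed_vector"
  assumes "continuous_on (UNIV \<times> D \<times> {-e..e}) (\<lambda>(t, x, \<epsilon>). R t x \<epsilon>)"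
    and "open D" "z \<in> D" "e > (0::real)" "(X \<longlongrightarrow> z) (at 0)"
  shows "vanishes_to_order 0 (\<lambda>\<epsilon>. R t (X \<epsilon>) \<epsilon>)"
proof -
  let ?S = "UNIV \<times> D \<times> {-e<..<e}"
  have "continuous_on ?S (\<lambda>(t, x, \<epsilon>). R t x \<epsilon>)"
    by (rule continuous_on_subset[OF assms(1)]) auto
  moreover have "open ?S" using assms(2) by (intro open_Times) auto
  moreover have "(t, z, 0) \<in> ?S" using assms(3,4) by simp
  ultimately have "isCont (\<lambda>(t, x, \<epsilon>). R t x \<epsilon>) (t, z, 0)"
    using continuous_on_eq_continuous_at by blast
  moreover have "((\<lambda>\<epsilon>. (t, X \<epsilon>, \<epsilon>)) \<longlongrightarrow> (t, z, 0)) (at 0)"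
    by (intro tendsto_Pair tendsto_const assms(5) tendsto_ident_at)
  ultimately have "((\<lambda>\<epsilon>. (\<lambda>(t, x, \<epsilon>). R t x \<epsilon>) (t, X \<epsilon>, \<epsilon>)) \<longlongrightarrow> (\<lambda>(t, x, \<epsilon>). R t x \<epsilon>) (t, z, 0)) (at 0)"
    by (rule isCont_tendsto_compose)
  then show ?thesis by (intro vanishes_to_order_tendsto) simp
qed

lemma near_identity_tendsto: "((\<lambda>\<epsilon>. near_identity k u t z \<epsilon>) \<longlongrightarrow> z) (at 0)"
  unfolding near_identity_def by (auto intro!: tendsto_eq_intros sum.neutral)

text \<open>
  Comparison of the coefficients of $\varepsilon^i$ in the equation that says that the near-identity
  transformation carries one differential equation to the other. On the left, the averaged vector field
  vanishes to order $i$ at the given point because its lower coefficients do; the derivative of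
  $U(t, \cdot, \varepsilon)$ differs from the identity by $O(\varepsilon)$, so only $\mathbf{g}_i$ itself
  survives next to $\partial_t \mathbf{u}_i$. The right-hand side is expanded by the formula of
  Faa di Bruno.
\<close>

lemma coefficient_identity:
  fixes F u :: "nat \<Rightarrow> real \<Rightarrow> 'a::euclidean_space \<Rightarrow> 'a"
  assumes "open D" "z \<in> D"
    and F: "\<And>j. j \<in> {1..k} \<Longrightarrow> smooth_on (UNIV \<times> D) (\<lambda>(t, x). F j t x)"
    and u: "\<And>j. j \<in> {1..k} \<Longrightarrow> smooth_on (UNIV \<times> D) (\<lambda>(t, x). u j t x)"
    and \<rho>: "vanishes_to_order 0 \<rho>" and \<sigma>: "vanishes_to_order 0 \<sigma>"
    and transforms: "\<forall>\<^sub>F \<epsilon> in at 0.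
      vector_derivative (\<lambda>s. near_identity k u s z \<epsilon>) (at t) +
      frechet_derivative (\<lambda>x. near_identity k u t x \<epsilon>) (at z)
        ((\<Sum>j=1..k. \<epsilon> ^ j *\<^sub>R g j) + \<epsilon> ^ (k + 1) *\<^sub>R \<rho> \<epsilon>) =
      (\<Sum>j=1..k. \<epsilon> ^ j *\<^sub>R F j t (near_identity k u t z \<epsilon>)) + \<epsilon> ^ (k + 1) *\<^sub>R \<sigma> \<epsilon>"
    and i: "i \<in> {1..k}" and g0: "\<And>j. j \<in> {1..<i} \<Longrightarrow> g j = 0"
  shows "frechet_derivative (\<lambda>(s, x). u i s x) (at (t, z)) (1, 0) + g i =
    F i t z + (\<Sum>j\<in>{1..<i}. faa_di_bruno_coeff (F (i - j) t) z (\<lambda>l. fact l *\<^sub>R u l t z) j)"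
proof -
  define w where "w j = frechet_derivative (\<lambda>(s, x). u j s x) (at (t, z)) (1, 0)" for j
  define A where "A j = (\<lambda>v. frechet_derivative (\<lambda>(s, x). u j s x) (at (t, z)) (0, v))" for j
  define V where "V \<epsilon> = (\<Sum>j=1..k. \<epsilon> ^ j *\<^sub>R g j) + \<epsilon> ^ (k + 1) *\<^sub>R \<rho> \<epsilon>" for \<epsilon>
  define c where "c j = faa_di_bruno_coeff (F j t) z (\<lambda>l. fact l *\<^sub>R u l t z)" for j
  have diff: "(\<lambda>(s, x). u j s x) differentiable at (t, z)" if "j \<in> {1..k}" for j
    using smooth_on_differentiable[OF u[OF that]] assms(1,2) by (simp add: open_Times)
  have dt: "vector_derivative (\<lambda>s. near_identity k u s z \<epsilon>) (at t) = (\<Sum>j=1..k. \<epsilon> ^ j *\<^sub>R w j)" for \<epsilon>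
  proof (rule vector_derivative_at)
    have "((\<lambda>s. \<epsilon> ^ j *\<^sub>R u j s z) has_vector_derivative \<epsilon> ^ j *\<^sub>R w j) (at t)" if "j \<in> {1..k}" for j
      using bounded_linear.has_vector_derivative[OF bounded_linear_scaleR_right
          has_vector_derivative_time[OF diff[OF that]]] by (simp add: w_def)
    then have "((\<lambda>s. z + (\<Sum>j=1..k. \<epsilon> ^ j *\<^sub>R u j s z)) has_vector_derivative
        0 + (\<Sum>j=1..k. \<epsilon> ^ j *\<^sub>R w j)) (at t)"
      by (intro has_vector_derivative_add has_vector_derivative_const has_vector_derivative_sum)
    then show "((\<lambda>s. near_identity k u s z \<epsilon>) has_vector_derivative (\<Sum>j=1..k. \<epsilon> ^ j *\<^sub>R w j)) (at t)"
      by (simp add: near_identity_def)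
  qed
  have A: "((\<lambda>x. u j t x) has_derivative A j) (at z)" if "j \<in> {1..k}" for j
    using has_derivative_slice[OF diff[OF that]] by (simp add: A_def)
  have dx: "frechet_derivative (\<lambda>x. near_identity k u t x \<epsilon>) (at z) =
      (\<lambda>v. v + (\<Sum>j=1..k. \<epsilon> ^ j *\<^sub>R A j v))" for \<epsilon>
  proof -
    have "((\<lambda>x. near_identity k u t x \<epsilon>) has_derivative (\<lambda>v. v + (\<Sum>j=1..k. \<epsilon> ^ j *\<^sub>R A j v))) (at z)"
      unfolding near_identity_def
      by (intro has_derivative_add has_derivative_ident has_derivative_sum
          has_derivative_scaleR_right A)
    then show ?thesis by (rule frechet_derivative_at[symmetric])
  qed
  have V: "vanishes_to_order i V"
    unfolding V_def
  proof (intro vanishes_to_order_add vanishes_to_order_sum)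
    show "vanishes_to_order i (\<lambda>\<epsilon>. \<epsilon> ^ j *\<^sub>R g j)" if "j \<in> {1..k}" for j
      using that g0[of j] by (cases "j < i") (auto intro: vanishes_to_order_monomial)
    show "vanishes_to_order i (\<lambda>\<epsilon>. \<epsilon> ^ (k + 1) *\<^sub>R \<rho> \<epsilon>)"
      using i by (intro vanishes_to_order_power_scaleR[OF \<rho>]) auto
  qed
  have AV: "vanishes_to_order (Suc i) (\<lambda>\<epsilon>. \<Sum>j=1..k. \<epsilon> ^ j *\<^sub>R A j (V \<epsilon>))"
  proof (rule vanishes_to_order_sum)
    fix j assume j: "j \<in> {1..k}"
    then show "vanishes_to_order (Suc i) (\<lambda>\<epsilon>. \<epsilon> ^ j *\<^sub>R A j (V \<epsilon>))"
      by (intro vanishes_to_order_power_scaleR[OF vanishes_to_order_bounded_linear[OF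
            has_derivative_bounded_linear[OF A[OF j]] V]]) auto
  qed
  have tail: "expands (Suc i) (\<lambda>\<epsilon>. \<epsilon> ^ (k + 1) *\<^sub>R \<phi> \<epsilon>) (\<lambda>_. 0)"
    if "vanishes_to_order 0 \<phi>" for \<phi> :: "real \<Rightarrow> 'a"
    using i by (intro expands_vanishing vanishes_to_order_power_scaleR[OF that]) auto
  have "expands (Suc i) (\<lambda>\<epsilon>. (\<Sum>j=1..k. \<epsilon> ^ j *\<^sub>R w j) + (V \<epsilon> + (\<Sum>j=1..k. \<epsilon> ^ j *\<^sub>R A j (V \<epsilon>))))
      (\<lambda>q. (if q \<in> {1..k} then w q else 0) + ((if q \<in> {1..k} then g q else 0) + 0 + 0))"
    unfolding V_def
    by (intro expands_add expands_polynomial tail \<rho> finite_atLeastAtMost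
        expands_vanishing AV[unfolded V_def])
  moreover have "\<forall>\<^sub>F \<epsilon> in at 0. (\<Sum>j=1..k. \<epsilon> ^ j *\<^sub>R w j) + (V \<epsilon> + (\<Sum>j=1..k. \<epsilon> ^ j *\<^sub>R A j (V \<epsilon>))) =
      (\<Sum>j=1..k. \<epsilon> ^ j *\<^sub>R F j t (near_identity k u t z \<epsilon>)) + \<epsilon> ^ (k + 1) *\<^sub>R \<sigma> \<epsilon>"
    using transforms unfolding dt dx V_def .
  ultimately have lhs: "expands (Suc i)
      (\<lambda>\<epsilon>. (\<Sum>j=1..k. \<epsilon> ^ j *\<^sub>R F j t (near_identity k u t z \<epsilon>)) + \<epsilon> ^ (k + 1) *\<^sub>R \<sigma> \<epsilon>)
      (\<lambda>q. (if q \<in> {1..k} then w q else 0) + ((if q \<in> {1..k} then g q else 0) + 0 + 0))"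
    by (rule expands_cong)
  have "expands (Suc i) (\<lambda>\<epsilon>. F j t (near_identity k u t z \<epsilon>)) (c j)" if "j \<in> {1..k}" for j
  proof -
    have "smooth_on D (F j t)" using smooth_on_slice[OF F[OF that] assms(1), of t] by simp
    from faa_di_bruno_expands[OF this assms(1,2), of "Suc i" k "\<lambda>l. fact l *\<^sub>R u l t z"]
    show ?thesis using i by (simp add: c_def near_identity_def)
  qed
  then have rhs: "expands (Suc i)
      (\<lambda>\<epsilon>. (\<Sum>j=1..k. \<epsilon> ^ j *\<^sub>R F j t (near_identity k u t z \<epsilon>)) + \<epsilon> ^ (k + 1) *\<^sub>R \<sigma> \<epsilon>)
      (\<lambda>q. (\<Sum>j=1..k. if q < j then 0 else c j (q - j)) + 0)"
    by (intro expands_add expands_sum expands_shift tail \<sigma>)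
  have "w i + g i = (\<Sum>j=1..k. if i < j then 0 else c j (i - j))"
    using expands_unique[OF lhs rhs, of i] i by simp
  also have "\<dots> = (\<Sum>j=1..i. c j (i - j))"
    using i by (intro sum.mono_neutral_cong_right) auto
  also have "\<dots> = c i 0 + (\<Sum>j\<in>{1..<i}. c j (i - j))"
  proof -
    have "{1..i} = insert i {1..<i}" using i by auto
    then show ?thesis by simp
  qed
  also have "(\<Sum>j\<in>{1..<i}. c j (i - j)) = (\<Sum>j\<in>{1..<i}. c (i - j) j)"
    by (rule sum.reindex_bij_witness[of _ "\<lambda>j. i - j" "\<lambda>j. i - j"]) auto
  finally show ?thesis by (simp add: w_def c_def faa_di_bruno_coeff_def)
qed

text \<open>
  The Melnikov integrand is $i!$ times the coefficient of $\varepsilon^i$ in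
  $\sum_j \varepsilon^j F_j$ along the curve $z + \sum_l \varepsilon^l v_l$, once the lower Melnikov
  functions are known to be $l!\, v_l$.
\<close>

lemma melnikov_y_eq_integral:
  assumes "\<And>l s. l \<in> {1..<i} \<Longrightarrow> melnikov_y F l s z = fact l *\<^sub>R v l s"
  shows "melnikov_y F i t z = (LBINT s=0..t. fact i *\<^sub>R (F i s z +
    (\<Sum>j\<in>{1..<i}. faa_di_bruno_coeff (F (i - j) s) z (\<lambda>l. fact l *\<^sub>R v l s) j)))"
proof -
  have "fact i *\<^sub>R F i s z + (\<Sum>j\<in>{1..<i}. \<Sum>m\<in>{1..j}. (fact i / fact j) *\<^sub>R
        bell_apply j m (\<lambda>vs. frechet_nth (F (i - j) s) vs z) (\<lambda>l. melnikov_y F l s z)) =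
      fact i *\<^sub>R (F i s z +
        (\<Sum>j\<in>{1..<i}. faa_di_bruno_coeff (F (i - j) s) z (\<lambda>l. fact l *\<^sub>R v l s) j))" for s
  proof -
    have "(\<Sum>m\<in>{1..j}. (fact i / fact j) *\<^sub>R
          bell_apply j m (\<lambda>vs. frechet_nth (F (i - j) s) vs z) (\<lambda>l. melnikov_y F l s z)) =
        fact i *\<^sub>R faa_di_bruno_coeff (F (i - j) s) z (\<lambda>l. fact l *\<^sub>R v l s) j"
      if j: "j \<in> {1..<i}" for j
    proof -
      have "bell_apply j m L (\<lambda>l. melnikov_y F l s z) = bell_apply j m L (\<lambda>l. fact l *\<^sub>R v l s)"
        if "m \<in> {1..j}" for m and L :: "'a list \<Rightarrow> 'a"
        by (rule bell_apply_cong) (use assms j that in auto)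
      then show ?thesis
        using j by (simp add: faa_di_bruno_coeff_def scaleR_sum_right divide_inverse)
    qed
    then show ?thesis by (simp add: scaleR_add_right scaleR_sum_right)
  qed
  then show ?thesis by (subst melnikov_y.simps) simp
qed

text \<open>
  If the lower averaged functions vanish at $z$, then
  $y_i(t, z) = i!\,(\mathbf{u}_i(t, z) + t\,\mathbf{g}_i(z))$ for all $t$: by induction the lower $y_l$
  are $l!\,\mathbf{u}_l$, so the comparison of coefficients identifies the integrand that defines $y_i$
  with the time derivative of the right-hand side, and both sides vanish at $t = 0$ by the stroboscopic
  condition. At $t = T$ periodicity removes $\mathbf{u}_i$.
\<close>

lemma melnikov_eq_averaged:
  assumes "open D" "z \<in> D" "\<epsilon>\<^sub>0 > 0"
    and F: "\<And>j. j \<in> {1..k} \<Longrightarrow> smooth_on (UNIV \<times> D) (\<lambda>(t, x). F j t x)"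
    and R: "continuous_on (UNIV \<times> D \<times> {-\<epsilon>\<^sub>0..\<epsilon>\<^sub>0}) (\<lambda>(t, x, \<epsilon>). R t x \<epsilon>)"
    and avg: "stroboscopic_averaged D T \<epsilon>\<^sub>0 k F R g"
    and "i \<in> {1..k}" "\<And>j. j \<in> {1..<i} \<Longrightarrow> g j z = 0"
  shows "melnikov F T i z = T *\<^sub>R g i z"
proof -
  obtain u r where u: "\<And>j. j \<in> {1..k} \<Longrightarrow> smooth_on (UNIV \<times> D) (\<lambda>(t, \<xi>). u j t \<xi>)"
    and periodic: "\<And>j t. j \<in> {1..k} \<Longrightarrow> u j (t + T) z = u j t z"
    and strobe: "\<And>\<epsilon>. \<epsilon> \<in> {-\<epsilon>\<^sub>0..\<epsilon>\<^sub>0} \<Longrightarrow> near_identity k u 0 z \<epsilon> = z"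
    and local: "\<And>V. open V \<Longrightarrow> compact (closure V) \<Longrightarrow> closure V \<subseteq> D \<Longrightarrow>
      \<exists>e\<in>{0<..\<epsilon>\<^sub>0}. smooth_on (UNIV \<times> V \<times> {-e..e}) (\<lambda>(t, \<xi>, \<epsilon>). r t \<xi> \<epsilon>) \<and>
        (\<forall>t. \<forall>\<xi>\<in>V. \<forall>\<epsilon>\<in>{-e..e}.
           r (t + T) \<xi> \<epsilon> = r t \<xi> \<epsilon> \<and> near_identity k u t \<xi> \<epsilon> \<in> D \<and>
           vector_derivative (\<lambda>s. near_identity k u s \<xi> \<epsilon>) (at t) +
           frechet_derivative (\<lambda>x. near_identity k u t x \<epsilon>) (at \<xi>)
             ((\<Sum>i=1..k. \<epsilon> ^ i *\<^sub>R g i \<xi>) + \<epsilon> ^ (k + 1) *\<^sub>R r t \<xi> \<epsilon>) =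
           (\<Sum>i=1..k. \<epsilon> ^ i *\<^sub>R F i t (near_identity k u t \<xi> \<epsilon>)) +
           \<epsilon> ^ (k + 1) *\<^sub>R R t (near_identity k u t \<xi> \<epsilon>) \<epsilon>)"
    using avg \<open>z \<in> D\<close> unfolding stroboscopic_averaged_def by (elim conjE exE) blast
  have near_0: "\<forall>\<^sub>F \<epsilon> in at 0. \<epsilon> \<in> {-e..e}" if "e > 0" for e :: real
    unfolding eventually_at by (rule exI[of _ e]) (use that in \<open>auto simp: dist_real_def\<close>)
  have u0: "u j 0 z = 0" if j: "j \<in> {1..k}" for j
  proof -
    have "\<forall>\<^sub>F \<epsilon> in at 0. (\<Sum>j=1..k. \<epsilon> ^ j *\<^sub>R u j 0 z) = 0"
      using near_0[OF \<open>\<epsilon>\<^sub>0 > 0\<close>] by eventually_elim (use strobe in \<open>simp add: near_identity_def\<close>)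
    from expands_unique[OF expands_cong[OF expands_polynomial this] expands_vanishing, of "Suc j" j]
    show ?thesis using j by simp
  qed
  obtain \<delta> where \<delta>: "\<delta> > 0" "cball z \<delta> \<subseteq> D"
    using assms(1,2) open_contains_cball by blast
  obtain e where e: "e \<in> {0<..\<epsilon>\<^sub>0}"
    and r: "smooth_on (UNIV \<times> ball z \<delta> \<times> {-e..e}) (\<lambda>(t, \<xi>, \<epsilon>). r t \<xi> \<epsilon>)"
    and transforms: "\<And>t \<epsilon>. \<epsilon> \<in> {-e..e} \<Longrightarrow>
      vector_derivative (\<lambda>s. near_identity k u s z \<epsilon>) (at t) +
      frechet_derivative (\<lambda>x. near_identity k u t x \<epsilon>) (at z)
        ((\<Sum>i=1..k. \<epsilon> ^ i *\<^sub>R g i z) + \<epsilon> ^ (k + 1) *\<^sub>R r t z \<epsilon>) =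
      (\<Sum>i=1..k. \<epsilon> ^ i *\<^sub>R F i t (near_identity k u t z \<epsilon>)) +
      \<epsilon> ^ (k + 1) *\<^sub>R R t (near_identity k u t z \<epsilon>) \<epsilon>"
    using local[of "ball z \<delta>"] \<delta> by (auto simp: Ball_def)
  have r0: "vanishes_to_order 0 (r t z)" for t
    using vanishes_to_order_0_along_parameter[OF smooth_on_continuous_on[OF r] open_ball _ _ tendsto_const, of z t]
      \<delta>(1) e by simp
  have R0: "vanishes_to_order 0 (\<lambda>\<epsilon>. R t (near_identity k u t z \<epsilon>) \<epsilon>)" for t
    by (rule vanishes_to_order_0_along_parameter[OF R assms(1,2,3) near_identity_tendsto])
  define w where "w j s = frechet_derivative (\<lambda>(s, x). u j s x) (at (s, z)) (1, 0)" for j s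
  have y: "melnikov_y F j t z = fact j *\<^sub>R (u j t z + t *\<^sub>R g j z)"
    if "j \<in> {1..k}" "\<And>l. l \<in> {1..<j} \<Longrightarrow> g l z = 0" for j t
    using that
  proof (induction j arbitrary: t rule: less_induct)
    case (less j)
    have lower: "melnikov_y F l s z = fact l *\<^sub>R u l s z" if "l \<in> {1..<j}" for l s
      using less.IH[of l s] less.prems that by auto
    have coeff: "w j s + g j z = F j s z +
        (\<Sum>l\<in>{1..<j}. faa_di_bruno_coeff (F (j - l) s) z (\<lambda>l. fact l *\<^sub>R u l s z) l)" for s
      unfolding w_def
    proof (rule coefficient_identity[OF assms(1,2) F u r0 R0 _ less.prems])
      show "\<forall>\<^sub>F \<epsilon> in at 0.
        vector_derivative (\<lambda>s. near_identity k u s z \<epsilon>) (at s) +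
        frechet_derivative (\<lambda>x. near_identity k u s x \<epsilon>) (at z)
          ((\<Sum>j=1..k. \<epsilon> ^ j *\<^sub>R g j z) + \<epsilon> ^ (k + 1) *\<^sub>R r s z \<epsilon>) =
        (\<Sum>j=1..k. \<epsilon> ^ j *\<^sub>R F j s (near_identity k u s z \<epsilon>)) +
        \<epsilon> ^ (k + 1) *\<^sub>R R s (near_identity k u s z \<epsilon>) \<epsilon>"
        by (rule eventually_mono[OF near_0[of e] transforms]) (use e in auto)
    qed
    have "melnikov_y F j t z = (LBINT s=0..t. fact j *\<^sub>R (w j s + g j z))"
      unfolding coeff by (rule melnikov_y_eq_integral[where v = "\<lambda>l s. u l s z", OF lower])
    also have "\<dots> = fact j *\<^sub>R (u j t z + t *\<^sub>R g j z) - fact j *\<^sub>R (u j 0 z + 0 *\<^sub>R g j z)"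
      unfolding zero_ereal_def
    proof (rule interval_integral_FTC_finite)
      have op: "open (UNIV \<times> D)" using assms(1) by (simp add: open_Times)
      have "continuous_on (UNIV \<times> D) (\<lambda>p. frechet_derivative (\<lambda>(s, x). u j s x) (at p) (1, 0))"
        using smooth_on_continuous_on[OF smooth_on_frechet_derivative[OF u[OF less.prems(1)] op]] .
      moreover have "continuous_on {min 0 t..max 0 t} (\<lambda>s. (s, z))"
        by (intro continuous_intros)
      moreover have "(\<lambda>s. (s, z)) ` {min 0 t..max 0 t} \<subseteq> UNIV \<times> D"
        using assms(2) by auto
      ultimately have "continuous_on {min 0 t..max 0 t} (w j)"
        unfolding w_def by (rule continuous_on_compose2)
      then show "continuous_on {min 0 t..max 0 t} (\<lambda>s. fact j *\<^sub>R (w j s + g j z))"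
        by (intro continuous_intros)
      show "((\<lambda>s. fact j *\<^sub>R (u j s z + s *\<^sub>R g j z)) has_vector_derivative
          fact j *\<^sub>R (w j s + g j z)) (at s within {min 0 t..max 0 t})" for s
      proof -
        have "(\<lambda>(s, x). u j s x) differentiable at (s, z)"
          using smooth_on_differentiable[OF u[OF less.prems(1)] op] assms(2) by simp
        from has_vector_derivative_time[OF this]
        have "((\<lambda>s. u j s z) has_vector_derivative w j s) (at s)" by (simp add: w_def)
        moreover have "((\<lambda>s. s *\<^sub>R g j z) has_vector_derivative g j z) (at s)"
          unfolding has_vector_derivative_def by (auto intro!: derivative_eq_intros)
        ultimately have "((\<lambda>s. u j s z + s *\<^sub>R g j z) has_vector_derivative w j s + g j z) (at s)"
          by (rule has_vector_derivative_add)
        from bounded_linear.has_vector_derivative[OF bounded_linear_scaleR_right this]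
        show ?thesis by (rule has_vector_derivative_at_within)
      qed
    qed
    finally show ?case using u0[OF less.prems(1)] by simp
  qed
  have "u i T z = 0" using periodic[of i 0] u0[of i] assms(7) by simp
  with y[OF assms(7,8)] show ?thesis by (simp add: melnikov_def)
qed

theorem corollary1:
  fixes k l :: nat
    and D :: "(real ^ 'n) set"
    and T \<epsilon>\<^sub>0 :: real
    and F :: "nat \<Rightarrow> real \<Rightarrow> real ^ 'n \<Rightarrow> real ^ 'n"
    and R :: "real \<Rightarrow> real ^ 'n \<Rightarrow> real \<Rightarrow> real ^ 'n"
    and g :: "nat \<Rightarrow> real ^ 'n \<Rightarrow> real ^ 'n"
  assumes "k \<ge> 2" and "open D" and "T > 0" and "\<epsilon>\<^sub>0 > 0"
    and "\<And>i. i \<in> {1..k} \<Longrightarrow> smooth_on (UNIV \<times> D) (\<lambda>(t, x). F i t x)"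
    and "\<And>i t x. i \<in> {1..k} \<Longrightarrow> x \<in> D \<Longrightarrow> F i (t + T) x = F i t x"
    and "smooth_on (UNIV \<times> D \<times> {-\<epsilon>\<^sub>0..\<epsilon>\<^sub>0}) (\<lambda>(t, x, \<epsilon>). R t x \<epsilon>)"
    and "\<And>t x \<epsilon>. x \<in> D \<Longrightarrow> \<epsilon> \<in> {-\<epsilon>\<^sub>0..\<epsilon>\<^sub>0} \<Longrightarrow> R (t + T) x \<epsilon> = R t x \<epsilon>"
    and "stroboscopic_averaged D T \<epsilon>\<^sub>0 k F R g"
    and "l \<in> {2..k}"
    and "(\<forall>i\<in>{1..l - 1}. \<forall>z\<in>D. melnikov F T i z = 0) \<or>
         (\<forall>i\<in>{1..l - 1}. \<forall>z\<in>D. g i z = 0)"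
  shows "\<forall>i\<in>{1..l}. \<forall>z\<in>D. melnikov F T i z = T *\<^sub>R g i z"
proof -
  have eq: "melnikov F T i z = T *\<^sub>R g i z"
    if "z \<in> D" "i \<in> {1..l}" "\<And>j. j \<in> {1..<i} \<Longrightarrow> g j z = 0" for i z
    by (rule melnikov_eq_averaged[OF assms(2) that(1) assms(4,5)
          smooth_on_continuous_on[OF assms(7)] assms(9) _ that(3)])
       (use that(2) assms(10) in auto)
  \<comment> \<open>If the $\mathbf{f}_j$ vanish instead, then $T\,\mathbf{g}_i = \mathbf{f}_i = 0$ gives one $\mathbf{g}_i$ after the other.\<close>
  have zero: "g i z = 0" if "z \<in> D" "i \<in> {1..l - 1}" for i z
    using assms(11)
  proof
    assume f: "\<forall>i\<in>{1..l - 1}. \<forall>z\<in>D. melnikov F T i z = 0"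
    from that(2) show ?thesis
    proof (induction i rule: less_induct)
      case (less i)
      have "melnikov F T i z = T *\<^sub>R g i z"
        using less by (intro eq that) auto
      with f less.prems that(1) \<open>T > 0\<close> show ?case by simp
    qed
  qed (use that in blast)
  show ?thesis
    by (intro ballI eq zero) auto
qed

end
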